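(* Let $a>0$ be real, $d\ge2$ an integer, and let $m$ be real with $a^d<m\le 2^{d-1}a^d$. Then there is a unique real $\lambda_0=\lambda_0(a,d,m)\ge 2d-2$ satisfying $$1+\sum_{k=1}^{\lfloor d/2\rfloor}\binom{d}{2k}\frac{(2k-1)!!}{\prod_{j=1}^k(\lambda_0-2d+2j+1)}=\frac{m}{a^d},$$ and every monic polynomial $f$ of degree $d$ with $d$ real roots (counted with multiplicity) and $|f(ai)|=m$ satisfies $$\Delta_f\le\Delta_G,\qquad G=G_{a,\lambda_0}.$$ Moreover, equality is attained if and only if $f(x)=G_{a,\lambda_0}(x)$. Finally, for every integer $d\ge 2$ and any $\lambda,a\in\mathbb{C}$ with $\lambda\notin\{2\lceil d/2\rceil-1,\,2\lceil d/2\rceil+1,\dots,2d-3\}$, $$\Delta_{G_{a,\lambda}}=a^{d(d-1)}\,\frac{\prod_{k=1}^d k^k\ \prod_{k=1}^{\lfloor d/2\rfloor-1}(\lambda-2k)^{2k}}{\prod_{k=\lceil d/2\rceil}^{d-1}(\lambda-2k+1)^{2k-1}}.$$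
   Context: For a monic polynomial $f(x)=\prod_{k=1}^d(x-x_k)$, the discriminant is $\Delta_f=\prod_{1\le j<k\le d}(x_j-x_k)^2$. For an integer $d\ge2$, and $a,\lambda\in\mathbb{C}$ with $\lambda\notin\{2\lceil d/2\rceil-1,2\lceil d/2\rceil+1,\dots,2d-3\}$, define the monic polynomial of degree $d$ $$G_{a,\lambda}(x):=x^d+\sum_{k=1}^{\lfloor d/2\rfloor}\left((-1)^ka^{2k}\binom{d}{2k}\frac{(2k-1)!!}{\prod_{j=1}^k(\lambda-2d+2j+1)}\right)x^{d-2k}.$$ Here $(2k-1)!!=1\cdot3\cdots(2k-1)$, empty products equal $1$, and $i=\sqrt{-1}$. *)

theory Defs
  imports
    "HOL-Analysis.Analysis"
    "HOL-Computational_Algebra.Computational_Algebra"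
    "HOL-Combinatorics.Permutations"
    "HOL-Library.Complex_Order"
begin

definition root_disc :: "complex list \<Rightarrow> complex" where
  "root_disc xs = (\<Prod>k<length xs. \<Prod>j<k. (xs ! j - xs ! k)\<^sup>2)"

lemma root_disc_mset_cong:
  assumes "mset xs = mset ys"
  shows "root_disc xs = root_disc ys"
proof -
  define n where "n = length xs"
  have lys: "length ys = n" using assms unfolding n_def by (metis size_mset)
  obtain p where p: "p permutes {..<n}" and "permute_list p ys = xs"
    using mset_eq_permutation[OF assms] lys by metis
  then have xs: "xs ! i = ys ! p i" if "i < n" for i
    using that lys permute_list_nth[of p ys i] by auto
  have pn: "p i < n \<longleftrightarrow> i < n" for i
    using permutes_in_image[OF p, of i] by simp
  have qn: "inv p i < n \<longleftrightarrow> i < n" for i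
    using permutes_in_image[OF permutes_inv[OF p], of i] by simp
  have pq: "p (inv p i) = i" "inv p (p i) = i" for i
    using permutes_inverses[OF p] by auto
  have pne: "p i = p j \<longleftrightarrow> i = j" for i j
    by (metis pq(2))
  have qne: "inv p i = inv p j \<longleftrightarrow> i = j" for i j
    by (metis pq(1))
  let ?S = "Sigma {..<n} (\<lambda>k. {..<k})"
  let ?m = "\<lambda>r :: nat \<Rightarrow> nat. \<lambda>(k, j). (max (r k) (r j), min (r k) (r j))"
  have "root_disc xs = (\<Prod>(k, j)\<in>?S. (xs ! j - xs ! k)\<^sup>2)"
    unfolding root_disc_def n_def[symmetric] by (subst prod.Sigma) auto
  also have "\<dots> = (\<Prod>(k, j)\<in>?S. (ys ! j - ys ! k)\<^sup>2)"
  proof (rule prod.reindex_bij_witness[where i = "?m (inv p)" and j = "?m p"])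
    fix a assume "a \<in> ?S"
    then obtain k j where a: "a = (k, j)" "j < k" "k < n" by auto
    show "?m (inv p) (?m p a) = a"
      using a pq by (auto simp: max_def min_def)
    have "p k \<noteq> p j" using a pne by auto
    then show "?m p a \<in> ?S" using a pn[of k] pn[of j]
      by (auto simp: max_def min_def)
    show "(case ?m p a of (k, j) \<Rightarrow> (ys ! j - ys ! k)\<^sup>2) =
          (case a of (k, j) \<Rightarrow> (xs ! j - xs ! k)\<^sup>2)"
      using a xs[of k] xs[of j] by (auto simp: max_def min_def power2_commute)
  next
    fix a assume "a \<in> ?S"
    then obtain k j where a: "a = (k, j)" "j < k" "k < n" by auto
    show "?m p (?m (inv p) a) = a"
      using a pq by (auto simp: max_def min_def)
    have "inv p k \<noteq> inv p j" using a qne by auto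
    then show "?m (inv p) a \<in> ?S" using a qn[of k] qn[of j]
      by (auto simp: max_def min_def)
  qed
  also have "\<dots> = root_disc ys"
    unfolding root_disc_def lys by (subst prod.Sigma) auto
  finally show ?thesis .
qed

text \<open>Intended for monic polynomials only. The choice of the enumeration of the roots is
  immaterial by the lemma that follows.\<close>

definition poly_disc :: "complex poly \<Rightarrow> complex" where
  "poly_disc f = root_disc (SOME xs. mset xs = proots f)"

lemma poly_disc_eq:
  assumes "f = (\<Prod>x\<leftarrow>xs. [:- x, 1:])"
  shows "poly_disc f = (\<Prod>k<length xs. \<Prod>j<k. (xs ! j - xs ! k)\<^sup>2)"
proof -
  have "proots (\<Prod>x\<leftarrow>xs. [:- x, 1:]) = mset xs"
  proof (induction xs)
    case (Cons a xs)
    have "(\<Prod>x\<leftarrow>xs. [:- x, 1:]) \<noteq> 0"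
      by (auto simp: prod_list_zero_iff)
    then show ?case
      using Cons.IH proots_mult[of "[:- a, 1:]" "\<Prod>x\<leftarrow>xs. [:- x, 1:]"]
      by (simp del: mult_pCons_left mult_pCons_right)
  qed simp
  then have "proots f = mset xs" by (simp add: assms)
  moreover have "mset (SOME ys. mset ys = proots f) = proots f"
    by (rule someI_ex) (metis ex_mset)
  ultimately have "poly_disc f = root_disc xs"
    unfolding poly_disc_def by (intro root_disc_mset_cong) simp
  then show ?thesis by (simp add: root_disc_def)
qed

text \<open>\<open>odd_dfact k\<close> is the double factorial \<open>(2k - 1)!!\<close>; it is 1 for \<open>k = 0\<close>.\<close>

definition odd_dfact :: "nat \<Rightarrow> nat" where
  "odd_dfact k = (\<Prod>j=1..k. 2 * j - 1)"

definition G_poly :: "nat \<Rightarrow> complex \<Rightarrow> complex \<Rightarrow> complex poly" where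
  "G_poly d a l = monom 1 d +
     (\<Sum>k=1..d div 2.
        monom ((-1) ^ k * a ^ (2 * k) * of_nat (d choose (2 * k)) *
               (of_nat (odd_dfact k) /
                (\<Prod>j=1..k. l - 2 * of_nat d + 2 * of_nat j + 1)))
              (d - 2 * k))"

text \<open>Monic of degree \<open>d\<close>, with \<open>d\<close> real roots counted with multiplicity, and \<open>|f(ai)| = m\<close>.\<close>

definition admissible :: "nat \<Rightarrow> real \<Rightarrow> real \<Rightarrow> complex poly \<Rightarrow> bool" where
  "admissible d a m f \<longleftrightarrow>
     degree f = d \<and> lead_coeff f = 1 \<and>
     size {#z \<in># proots f. z \<in> \<real>#} = d \<and>
     cmod (poly f (complex_of_real a * \<i>)) = m"

end

theory Submission
  imports Defs
begin

text \<open>Write \<open>P = G_poly d a l\<close> and \<open>Q = G_poly (d - 1) a (l - 2)\<close>. Then \<open>P' = d Q\<close>, and \<open>P\<close> solves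
  \<open>(x\<^sup>2 + a\<^sup>2) P'' - l x P' + d (l - d + 1) P = 0\<close>. At a root \<open>y\<close> of \<open>Q\<close> this expresses \<open>P y\<close> through
  \<open>Q' y\<close>, which relates the discriminants of \<open>P\<close> and \<open>Q\<close> and gives the closed formula by
  induction as long as \<open>l\<close> is not an integer; the remaining parameters follow by continuity.

  The differential equation also says that the roots of \<open>P\<close> are a critical point of the
  discriminant under the constraint on \<open>\<bar>f(a i)\<bar>\<close>, with Lagrange multiplier \<open>l\<close>. Substituting
  \<open>x = a tan t\<close> turns \<open>x\<^sub>j - x\<^sub>k\<close> into \<open>a sin (t\<^sub>j - t\<^sub>k) / (cos t\<^sub>j cos t\<^sub>k)\<close> and \<open>x\<^sup>2 + a\<^sup>2\<close> into
  \<open>a\<^sup>2 / cos\<^sup>2 t\<close>. As \<open>ln sin\<close> and \<open>ln cos\<close> are strictly concave, for \<open>l \<ge> 2 d - 2\<close> the critical point is the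
  unique maximum.\<close>

subsection \<open>The polynomials G\<close>

text \<open>Includes \<open>k = 0\<close>, where the value is 1, so that the leading monomial can be
  treated as one more term of the sum.\<close>

definition G_coeff :: "nat \<Rightarrow> complex \<Rightarrow> complex \<Rightarrow> nat \<Rightarrow> complex" where
  "G_coeff d a l k = (-1) ^ k * a ^ (2 * k) * of_nat (d choose (2 * k)) *
     (of_nat (odd_dfact k) / (\<Prod>j=1..k. l - 2 * of_nat d + 2 * of_nat j + 1))"

text \<open>Factor \<open>j\<close> vanishes exactly at l = 2 (d - j) - 1. With k = d - j these are
  the parameters that the theorem excludes, see \<open>nonsingular_iff\<close>.\<close>

definition nonsingular :: "nat \<Rightarrow> complex \<Rightarrow> bool" where
  "nonsingular d l \<longleftrightarrow> (\<forall>j\<in>{1..d div 2}. l - 2 * of_nat d + 2 * of_nat j + 1 \<noteq> 0)"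

lemma odd_dfact_Suc: "odd_dfact (Suc k) = odd_dfact k * (2 * k + 1)"
  unfolding odd_dfact_def by (simp add: prod.nat_ivl_Suc' algebra_simps del: One_nat_def)

lemma G_poly_conv_sum: "G_poly d a l = (\<Sum>k=0..d div 2. monom (G_coeff d a l k) (d - 2 * k))"
  by (subst sum.atLeast_Suc_atMost) (simp_all add: G_poly_def G_coeff_def odd_dfact_def)

lemma coeff_G_poly:
  "coeff (G_poly d a l) n = (if n \<le> d \<and> even (d - n) then G_coeff d a l ((d - n) div 2) else 0)"
proof -
  have "coeff (G_poly d a l) n =
      (\<Sum>k=0..d div 2. if d - 2 * k = n then G_coeff d a l k else 0)"
    by (simp add: G_poly_conv_sum coeff_sum)
  also have "\<dots> = (\<Sum>k\<in>{k\<in>{0..d div 2}. d - 2 * k = n}. G_coeff d a l k)"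
    by (simp only: sum.inter_filter finite_atLeastAtMost)
  also have "{k\<in>{0..d div 2}. d - 2 * k = n} =
      (if n \<le> d \<and> even (d - n) then {(d - n) div 2} else {})"
    by auto
  finally show ?thesis by (simp del: even_diff_nat)
qed

lemma degree_G_poly [simp]: "degree (G_poly d a l) = d"
  and coeff_G_poly_degree [simp]: "coeff (G_poly d a l) d = 1"
proof -
  show 1: "coeff (G_poly d a l) d = 1"
    by (simp add: coeff_G_poly G_coeff_def odd_dfact_def)
  show "degree (G_poly d a l) = d"
    by (rule antisym, rule degree_le, simp add: coeff_G_poly, rule le_degree, simp add: 1)
qed

lemma binomial_deriv: "n \<le> d \<Longrightarrow> Suc (d - n) * (Suc d choose n) = Suc d * (d choose n)"
  using binomial_absorb_comp[of "Suc d" n] by (simp add: Suc_diff_le del: binomial_Suc_Suc)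

text \<open>Lowering the degree by 1 and the parameter by 2 leaves l - 2 d unchanged. The
  denominators therefore agree, and only a binomial identity remains.\<close>

lemma pderiv_G_poly:
  "pderiv (G_poly (Suc d) a l) = smult (of_nat (Suc d)) (G_poly d a (l - 2))"
proof (rule poly_eqI)
  fix n
  show "coeff (pderiv (G_poly (Suc d) a l)) n = coeff (smult (of_nat (Suc d)) (G_poly d a (l - 2))) n"
  proof (cases "n \<le> d \<and> even (d - n)")
    case True
    define k where "k = (d - n) div 2"
    have n: "n = d - 2 * k" "2 * k \<le> d" using True by (auto simp: k_def)
    have "of_nat (Suc (d - 2 * k)) * of_nat (Suc d choose (2*k)) = (of_nat (Suc d) * of_nat (d choose (2*k)) :: complex)"
      unfolding of_nat_mult[symmetric] using binomial_deriv[of "2*k" d] n by (simp only:)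
    note b = this
    have "of_nat (Suc n) * G_coeff (Suc d) a l k = of_nat (Suc d) * G_coeff d a (l - 2) k"
    proof -
      have "(\<Prod>j=1..k. l - 2 * of_nat (Suc d) + 2 * of_nat j + 1) = (\<Prod>j=1..k. l - 2 - 2 * of_nat d + 2 * of_nat j + 1 :: complex)"
        by (rule prod.cong) simp_all
      then show ?thesis unfolding G_coeff_def n(1)
        using arg_cong[OF b, of "\<lambda>x. (-1) ^ k * a ^ (2 * k) * (of_nat (odd_dfact k) /
          (\<Prod>j=1..k. l - 2 - 2 * of_nat d + 2 * of_nat j + 1)) * x"] by (simp only: ac_simps)
    qed
    then show ?thesis using True by (simp add: coeff_pderiv coeff_G_poly k_def del: of_nat_Suc)
  qed (auto simp add: coeff_pderiv coeff_G_poly)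
qed

text \<open>This is the differential equation read off at the coefficient of x^(d - 2 k - 2), with
  the denominators cleared.\<close>

lemma G_coeff_Suc:
  assumes "nonsingular d l" "2 * Suc k \<le> d"
  shows "2 * of_nat (Suc k) * (l - 2 * of_nat d + 2 * of_nat (Suc k) + 1) * G_coeff d a l (Suc k)
       = - (a\<^sup>2 * of_nat (d - 2 * k) * of_nat (d - 2 * k - 1) * G_coeff d a l k)"
proof -
  define A where "A = l - 2 * of_nat d + 2 * of_nat (Suc k) + 1"
  define p where "p = (\<Prod>j=1..k. l - 2 * of_nat d + 2 * of_nat j + 1)"
  have "A \<noteq> 0" "p \<noteq> 0" 
  proof -
    have *: "l - 2 * of_nat d + 2 * of_nat j + 1 \<noteq> 0" if "j \<in> {1..Suc k}" for j
      
    proof -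
      have "j \<in> {1..d div 2}" using that assms(2) by auto
      then show ?thesis using assms(1) unfolding nonsingular_def by blast
    qed
    show "A \<noteq> 0" unfolding A_def by (rule *) simp
    show "p \<noteq> 0" unfolding p_def prod_zero_iff[OF finite_atLeastAtMost] using * by force
  qed
  have "(2*k+1) * (d choose (2*k+1)) = (d - 2*k) * (d choose (2*k))"
    using binomial_absorption[of "2*k" d] binomial_absorb_comp[of d "2*k"] by simp
  from arg_cong[OF this, of "of_nat :: nat \<Rightarrow> complex"]
  have 1: "(2 * of_nat k + 1) * of_nat (d choose (2*k+1)) = (of_nat (d - 2*k) * of_nat (d choose (2*k)) :: complex)"
    by (simp only: of_nat_mult of_nat_add of_nat_numeral of_nat_1)
  have "(2*k+2) * (d choose (2*k+2)) = (d - 2*k - 1) * (d choose (2*k+1))"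
    using binomial_absorption[of "2*k+1" d] binomial_absorb_comp[of d "2*k+1"] by simp
  from arg_cong[OF this, of "of_nat :: nat \<Rightarrow> complex"]
  have 2: "(2 * of_nat k + 2) * of_nat (d choose (2*k+2)) = (of_nat (d - 2*k - 1) * of_nat (d choose (2*k+1)) :: complex)"
    by (simp only: of_nat_mult of_nat_add of_nat_numeral of_nat_1)
  have b: "(2 * of_nat k + 2) * (2 * of_nat k + 1) * of_nat (d choose (2 * k + 2))
      = (of_nat (d - 2*k) * of_nat (d - 2*k-1) * of_nat (d choose (2 * k)) :: complex)"
    using arg_cong[OF 2, of "\<lambda>x. (2 * of_nat k + 1) * x"] arg_cong[OF 1, of "\<lambda>x. of_nat (d - 2*k - 1) * x"]
    by (simp only: ac_simps)
  have "2 * of_nat (Suc k) * A * G_coeff d a l (Suc k) = 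
     - ((-1)^k * a^(2*k) * a\<^sup>2 * of_nat (odd_dfact k) / p) * ((2 * of_nat k + 2) * (2 * of_nat k + 1) * of_nat (d choose (2 * k + 2)))"
  proof -
    have "(\<Prod>j=1..Suc k. l - 2 * of_nat d + 2 * of_nat j + 1) = p * A"
      unfolding p_def A_def 
      using prod.nat_ivl_Suc'[of 1 k "\<lambda>j. l - 2 * of_nat d + 2 * of_nat j + 1"]
        by (simp only: mult.commute One_nat_def)
    moreover have "odd_dfact (Suc k) = odd_dfact k * (2 * k + 1)" "2 * Suc k = 2 * k + 2"
      by (simp_all add: odd_dfact_Suc)
    ultimately show ?thesis using \<open>A \<noteq> 0\<close> \<open>p \<noteq> 0\<close> unfolding G_coeff_def
      by (simp add: field_simps power2_eq_square)
  qed
  also have "\<dots> = - (a\<^sup>2 * of_nat (d - 2 * k) * of_nat (d - 2 * k - 1) * G_coeff d a l k)"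
    unfolding b by (simp add: G_coeff_def p_def)
  finally show ?thesis unfolding A_def .
qed

lemma G_poly_ode:
  assumes "nonsingular d l"
  shows "(x\<^sup>2 + a\<^sup>2) * poly (pderiv (pderiv (G_poly d a l))) x - l * x * poly (pderiv (G_poly d a l)) x
    + of_nat d * (l - of_nat d + 1) * poly (G_poly d a l) x = 0"
proof -
  define P where "P = G_poly d a l"
  have "[:a\<^sup>2, 0, 1:] * pderiv (pderiv P) - [:0, l:] * pderiv P + smult (of_nat d * (l - of_nat d + 1)) P = 0"
    (is "?L = 0")
  proof (rule poly_eqI)
    fix n
    have "coeff ?L n = a\<^sup>2 * of_nat (n + 1) * of_nat (n + 2) * coeff P (n + 2)
        + (of_nat d - of_nat n) * (l - of_nat d - of_nat n + 1) * coeff P n"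
      by (cases n) (simp_all add: coeff_pderiv coeff_pCons algebra_simps eval_nat_numeral split: nat.splits)
    also have "\<dots> = 0"
    proof (cases "n + 2 \<le> d \<and> even (d - n)")
      case True
      define k where "k = (d - n - 2) div 2"
      have n: "n = d - 2 * Suc k" "2 * Suc k \<le> d" "(d - (n + 2)) div 2 = k" "(d - n) div 2 = Suc k" 
        "d = n + 2 * Suc k" "d - 2 * k = n + 2" "d - 2 * k - 1 = n + 1"
        using True by (auto simp: k_def)
      show ?thesis using G_coeff_Suc[OF assms n(2), of a] True
        unfolding P_def coeff_G_poly n(3,4,6,7) by (simp add: n(5) algebra_simps)
    next
      case False
      \<comment> \<open>Outside the main case both terms vanish: by degree for n > d, through the
        factor d - n for n = d, and by parity otherwise. The value n = d - 1 falls under the odd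
        case.\<close>
      then consider "n > d" | "n = d" | "n \<le> d \<and> odd (d - n)"
        by (cases "n \<le> d"; cases "n = d"; cases "n = d - 1") auto
      then show ?thesis by cases (auto simp: P_def coeff_G_poly)
    qed
    finally show "coeff ?L n = coeff 0 n" by simp
  qed
  then have "poly ?L x = 0" by simp
  then show ?thesis by (simp add: P_def algebra_simps power2_eq_square)
qed

subsection \<open>Discriminants and roots\<close>

lemma root_disc_Cons:
  "root_disc (x # xs) = (\<Prod>y\<leftarrow>xs. x - y)\<^sup>2 * root_disc xs"
proof -
  have "root_disc (x # xs) = (\<Prod>k<length xs. (x - xs ! k)\<^sup>2 * (\<Prod>j<k. (xs ! j - xs ! k)\<^sup>2))"
    unfolding root_disc_def
    by (simp add: prod.lessThan_Suc_shift del: prod.lessThan_Suc)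
  also have "\<dots> = (\<Prod>k<length xs. x - xs ! k)\<^sup>2 * root_disc xs"
    by (simp add: root_disc_def prod.distrib prod_power_distrib)
  also have "(\<Prod>k<length xs. x - xs ! k) = (\<Prod>y\<leftarrow>xs. x - y)"
    by (simp add: prod.list_conv_set_nth atLeast0LessThan)
  finally show ?thesis .
qed

lemma poly_prod_list_roots: "poly (\<Prod>x\<leftarrow>xs. [:- x, 1:]) z = (\<Prod>x\<leftarrow>xs. z - x :: 'a :: idom)"
  by (induction xs) (simp_all add: algebra_simps)

lemma pderiv_linear_mult: "poly (pderiv ([:- x, 1:] * p)) z = poly p z + (z - x) * poly (pderiv p) z"
  for x :: "'a :: idom"
  unfolding pderiv_mult by (simp add: pderiv_pCons algebra_simps)

lemma prod_list_map_minus_commute: "(\<Prod>y\<leftarrow>ys. f y - g y :: 'a :: comm_ring_1) = (-1) ^ length ys * (\<Prod>y\<leftarrow>ys. g y - f y)"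
  by (induction ys) (simp_all add: algebra_simps)

lemma prod_list_map_mult: "(\<Prod>y\<leftarrow>ys. f y * g y) = (\<Prod>y\<leftarrow>ys. f y) * (\<Prod>y\<leftarrow>ys. g y :: 'a :: comm_monoid_mult)"
  by (induction ys) (simp_all add: ac_simps)

text \<open>At a root, the derivative is the product of the differences to the other roots. Each
  pair thus occurs twice with opposite signs, which gives one factor -1 per pair. In the induction
  the new root contributes the value of the old product twice, once by itself and once through the
  factors z - x.\<close>

lemma prod_pderiv_roots:
  "(\<Prod>x\<leftarrow>xs. poly (pderiv (\<Prod>y\<leftarrow>xs. [:- y, 1:])) x) = (-1) ^ (length xs choose 2) * root_disc xs"
proof (induction xs)
  case Nil
  show ?case by (simp add: root_disc_def numeral_2_eq_2)
next
  case (Cons x xs)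
  define F where "F = (\<Prod>y\<leftarrow>xs. [:- y, 1:])"
  have F: "poly F y = 0" if "y \<in> set xs" for y
    using that by (auto simp: F_def poly_prod_list_roots prod_list_zero_iff)
  have "(\<Prod>z\<leftarrow>x # xs. poly (pderiv (\<Prod>y\<leftarrow>x # xs. [:- y, 1:])) z)
      = poly F x * (\<Prod>z\<leftarrow>xs. poly (pderiv ([:- x, 1:] * F)) z)"
    unfolding list.map prod_list.Cons F_def[symmetric] pderiv_linear_mult by simp
  also have "(\<Prod>z\<leftarrow>xs. poly (pderiv ([:- x, 1:] * F)) z) = (\<Prod>z\<leftarrow>xs. (z - x) * poly (pderiv F) z)"
    unfolding pderiv_linear_mult using F by (simp cong: map_cong)
  also have "\<dots> = (-1) ^ length xs * poly F x * (\<Prod>z\<leftarrow>xs. poly (pderiv F) z)"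
    by (simp add: prod_list_map_mult prod_list_map_minus_commute[of "\<lambda>z. z" "\<lambda>_. x"] F_def poly_prod_list_roots)
  also have "(\<Prod>z\<leftarrow>xs. poly (pderiv F) z) = (-1) ^ (length xs choose 2) * root_disc xs"
    using Cons.IH by (simp add: F_def)
  also have "poly F x * ((-1) ^ length xs * poly F x * ((-1) ^ (length xs choose 2) * root_disc xs)) =
      (-1) ^ (length (x # xs) choose 2) * root_disc (x # xs)"
    by (simp add: root_disc_Cons F_def poly_prod_list_roots power2_eq_square numeral_2_eq_2 power_add)
  finally show ?case .
qed

lemma monic_complex_poly_roots:
  fixes f :: "complex poly"
  assumes "lead_coeff f = 1"
  obtains xs where "f = (\<Prod>x\<leftarrow>xs. [:- x, 1:])" "length xs = degree f" "mset xs = proots f"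
proof -
  obtain xs where xs: "mset xs = proots f" using ex_mset by blast
  have "f = smult (lead_coeff f) (\<Prod>x\<in>#proots f. [:-x, 1:])"
    by (rule complex_poly_decompose_multiset[symmetric])
  also have "\<dots> = (\<Prod>x\<leftarrow>xs. [:- x, 1:])"
    using assms by (simp add: xs[symmetric] prod_mset_prod_list flip: mset_map)
  finally have "f = (\<Prod>x\<leftarrow>xs. [:- x, 1:])" .
  moreover have "length xs = degree f" using size_proots_complex[of f] by (simp add: xs[symmetric])
  ultimately show ?thesis using xs that by blast
qed

lemma poly_disc_roots: "poly_disc (\<Prod>x\<leftarrow>xs. [:- x, 1:]) = root_disc xs"
  unfolding root_disc_def by (rule poly_disc_eq) simp

lemma prod_list_swap_diff:
  "(\<Prod>x\<leftarrow>xs. \<Prod>y\<leftarrow>ys. x - y :: 'a :: comm_ring_1) = (-1) ^ (length xs * length ys) * (\<Prod>y\<leftarrow>ys. \<Prod>x\<leftarrow>xs. y - x)"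
proof (induction xs)
  case (Cons x xs)
  then show ?case
    by (simp add: prod_list_map_mult prod_list_map_minus_commute[of "\<lambda>_. x"] power_add)
qed (induction ys, simp_all)

text \<open>Up to constants, the discriminant of \<open>P\<close> is the resultant of
  \<open>P\<close> and \<open>Q\<close>, which may be evaluated at the roots of \<open>Q\<close>
  instead. There \<open>P\<close> is a multiple of \<open>pderiv Q\<close>, whose product over these
  roots is the discriminant of \<open>Q\<close>. The factors y^2 + a^2 = (a i - y) (- a i - y)
  collect to the two values of \<open>Q\<close>.\<close>

lemma poly_disc_of_pderiv:
  assumes P: "lead_coeff P = 1" "degree P = Suc n" and Q: "lead_coeff Q = 1" "degree Q = n"
    and PQ: "pderiv P = smult (of_nat (Suc n)) Q"
    and c: "\<And>y. poly Q y = 0 \<Longrightarrow> poly P y = c * (y\<^sup>2 + a\<^sup>2) * poly (pderiv Q) y"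
  shows "poly_disc P = (-1) ^ n * of_nat (Suc n) ^ Suc n * c ^ n * (poly Q (a * \<i>) * poly Q (- (a * \<i>))) * poly_disc Q"
proof -
  obtain xs where xs: "P = (\<Prod>x\<leftarrow>xs. [:- x, 1:])" "length xs = Suc n"
    using monic_complex_poly_roots[of P] P by metis
  obtain ys where ys: "Q = (\<Prod>x\<leftarrow>ys. [:- x, 1:])" "length ys = n"
    using monic_complex_poly_roots[of Q] Q by metis
  have Q0: "poly Q y = 0" if "y \<in> set ys" for y
    using that by (auto simp: ys poly_prod_list_roots prod_list_zero_iff)
  have "(-1) ^ (Suc n choose 2) * poly_disc P = (\<Prod>x\<leftarrow>xs. poly (pderiv P) x)"
    unfolding xs(1) poly_disc_roots prod_pderiv_roots xs(2) ..
  also have "\<dots> = of_nat (Suc n) ^ Suc n * (\<Prod>x\<leftarrow>xs. \<Prod>y\<leftarrow>ys. x - y)"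
    unfolding PQ poly_smult prod_list_map_mult
      by (simp only: ys(1) poly_prod_list_roots map_replicate_const prod_list_replicate xs(2))
  \<comment> \<open>Exchanging the two products costs the sign (-1)^((n + 1) n), which is 1.\<close>
  also have "(\<Prod>x\<leftarrow>xs. \<Prod>y\<leftarrow>ys. x - y) = (\<Prod>y\<leftarrow>ys. poly P y)"
    
  proof -
    have "poly P y = (\<Prod>x\<leftarrow>xs. y - x)" for y
      by (simp add: xs(1) poly_prod_list_roots)
    then show ?thesis by (subst prod_list_swap_diff) (simp add: xs(2) ys(2) cong: map_cong)
  qed
  also have "\<dots> = (\<Prod>y\<leftarrow>ys. c * (((a * \<i>) - y) * (- (a * \<i>) - y)) * poly (pderiv Q) y)"
    by (rule arg_cong[of _ _ prod_list], rule map_cong) (simp_all add: c Q0 power2_eq_square algebra_simps)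
  also have "\<dots> = c ^ n * (poly Q (a * \<i>) * poly Q (- (a * \<i>))) * ((-1) ^ (n choose 2) * poly_disc Q)"
    unfolding prod_list_map_mult ys(1) poly_disc_roots prod_pderiv_roots poly_prod_list_roots map_replicate_const prod_list_replicate ys(2) ..
  finally have *: "(-1) ^ (Suc n choose 2) * poly_disc P = of_nat (Suc n) ^ Suc n *
      (c ^ n * (poly Q (a * \<i>) * poly Q (- (a * \<i>))) * ((-1) ^ (n choose 2) * poly_disc Q))" .
  have sgn: "(-1) ^ (Suc n choose 2) = (-1) ^ n * ((-1) ^ (n choose 2) :: complex)"
    by (simp add: numeral_2_eq_2 power_add)
  have sq: "(-1) ^ k * ((-1) ^ k * z) = z" for k and z :: complex
    by (simp flip: mult.assoc)
  show ?thesis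
    using arg_cong[OF *, of "\<lambda>z. (-1) ^ n * ((-1) ^ (n choose 2) * z)"]
    unfolding sgn by (simp add: sq ac_simps del: of_nat_Suc power_Suc)
qed

subsection \<open>The discriminant at non-integral parameters\<close>

text \<open>The factor by which the value of \<open>G_poly d a l\<close> at a i differs from (a
  i)^d; it does not depend on \<open>a\<close>. For real parameters it is the left-hand side of the
  equation for the parameter in the theorem.\<close>

definition H_value :: "nat \<Rightarrow> complex \<Rightarrow> complex" where
  "H_value d l = (\<Sum>k=0..d div 2. of_nat (d choose (2 * k)) *
     (of_nat (odd_dfact k) / (\<Prod>j=1..k. l - 2 * of_nat d + 2 * of_nat j + 1)))"

text \<open>The hypothesis on \<open>b\<close> covers both a i and - a i.\<close>

lemma poly_G_poly_imag:
  assumes "b\<^sup>2 = - (a\<^sup>2)"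
  shows "poly (G_poly d a l) b = b ^ d * H_value d l"
  unfolding G_poly_conv_sum H_value_def poly_sum poly_monom sum_distrib_left
proof (rule sum.cong)
  fix k assume "k \<in> {0..d div 2}"
  then have "b ^ d = (b\<^sup>2) ^ k * b ^ (d - 2 * k)"
    by (simp flip: power_mult power_add)
  also have "\<dots> = (-1) ^ k * a ^ (2 * k) * b ^ (d - 2 * k)"
    unfolding assms by (simp add: power_minus[of "a\<^sup>2"] power_mult)
  finally show "G_coeff d a l k * b ^ (d - 2 * k) = b ^ d * (of_nat (d choose (2 * k)) *
     (of_nat (odd_dfact k) / (\<Prod>j=1..k. l - 2 * of_nat d + 2 * of_nat j + 1)))"
    by (simp add: G_coeff_def)
qed simp

lemma nonsingular_nonint:
  assumes "l \<notin> \<int>"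
  shows "nonsingular d l"
  unfolding nonsingular_def
proof
  fix j show "l - 2 * of_nat d + 2 * of_nat j + 1 \<noteq> 0"
  proof
    assume "l - 2 * of_nat d + 2 * of_nat j + 1 = 0"
    then have "l = of_int (2 * int d - 2 * int j - 1)" by (simp add: algebra_simps)
    then show False using assms by (metis Ints_of_int)
  qed
qed

lemma nonint_diff_of_nat: "l \<notin> \<int> \<Longrightarrow> l - of_nat k \<noteq> (0 :: complex)"
  by auto

lemma G_poly_ode_Suc:
  assumes "nonsingular (Suc n) l"
  shows "(x\<^sup>2 + a\<^sup>2) * poly (pderiv (G_poly n a (l - 2))) x - l * x * poly (G_poly n a (l - 2)) x
    + (l - of_nat n) * poly (G_poly (Suc n) a l) x = 0"
proof -
  have "of_nat (Suc n) * ((x\<^sup>2 + a\<^sup>2) * poly (pderiv (G_poly n a (l - 2))) x - l * x * poly (G_poly n a (l - 2)) x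
    + (l - of_nat n) * poly (G_poly (Suc n) a l) x) = 0"
    using G_poly_ode[OF assms, of x a] unfolding pderiv_G_poly pderiv_smult poly_smult
    by (simp only: of_nat_Suc) (simp add: algebra_simps)
  then show ?thesis unfolding mult_eq_0_iff of_nat_eq_0_iff by simp
qed

text \<open>At x = i with a = 1 the factor x^2 + a^2 removes the derivative from the differential
  equation, leaving a relation between two values only. The choice a = 1 suffices because
  \<open>H_value\<close> is independent of \<open>a\<close>.\<close>

lemma H_value_Suc:
  assumes "nonsingular (Suc n) l"
  shows "(l - of_nat n) * H_value (Suc n) l = l * H_value n (l - 2)"
proof -
  have "(\<i>\<^sup>2 + 1\<^sup>2) * poly (pderiv (G_poly n 1 (l - 2))) \<i> - l * \<i> * (\<i> ^ n * H_value n (l - 2))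
    + (l - of_nat n) * (\<i> ^ Suc n * H_value (Suc n) l) = 0"
    using G_poly_ode_Suc[OF assms, of \<i> 1]
      by (simp only: poly_G_poly_imag[of \<i> 1] power2_i power_one)
  then have "\<i> ^ Suc n * ((l - of_nat n) * H_value (Suc n) l - l * H_value n (l - 2)) = 0"
    by (simp add: algebra_simps)
  then show ?thesis by simp
qed

lemma H_value_closed:
  assumes "l \<notin> \<int>" "n \<ge> 1"
  shows "H_value n l = (\<Prod>k<n div 2. l - 2 * of_nat k) / (\<Prod>k=(n + 1) div 2..n - 1. l - 2 * of_nat k + 1)"
  using assms(2,1)
proof (induction n arbitrary: l rule: nat_induct_at_least)
  case base
  show ?case by (simp add: H_value_def odd_dfact_def)
next
  case (Suc n)
  define N D where "N x m = (\<Prod>k<m. x - 2 * of_nat k)" and "D x r s = (\<Prod>k=r..s. x - 2 * of_nat k + 1)"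
    for x :: complex and m r s :: nat
  have l2: "l - 2 \<notin> \<int>" using Suc.prems by (metis Ints_add Ints_numeral diff_add_cancel)
  have "l \<noteq> 0" "l - of_nat n \<noteq> 0" using Suc.prems by auto
  have N: "N l (Suc m) = l * N (l - 2) m" for m
    unfolding N_def by (simp add: prod.lessThan_Suc_shift algebra_simps del: prod.lessThan_Suc)
  have D: "D l (Suc r) (Suc s) = D (l - 2) r s" for r s
    unfolding D_def prod.shift_bounds_cl_Suc_ivl by (simp add: algebra_simps)
  have D0: "D l r s \<noteq> 0" for r s
  proof -
    have "l - 2 * of_nat k + 1 \<noteq> 0" for k
    proof
      assume "l - 2 * of_nat k + 1 = 0"
      then have "l = of_int (2 * int k - 1)" by (simp add: algebra_simps)
      then show False using Suc.prems by (metis Ints_of_int)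
    qed
    then show ?thesis by (simp add: D_def)
  qed
  have "(l - of_nat n) * H_value (Suc n) l = l * (N (l - 2) (n div 2) / D (l - 2) ((n + 1) div 2) (n - 1))"
    using H_value_Suc[OF nonsingular_nonint[OF Suc.prems], of n] Suc.IH[OF l2]
      by (simp add: N_def D_def)
  also have "\<dots> = N l (Suc (n div 2)) / D l (Suc ((n + 1) div 2)) n"
    using Suc.hyps D[of "(n + 1) div 2" "n - 1"] by (simp add: N)
  \<comment> \<open>The factor l - n is disposed of by parity: for even n it is the last factor of
    the numerator, which is split off; for odd n it is the first factor that the denominator
    gains.\<close>
  also have "\<dots> = (l - of_nat n) * (N l (Suc n div 2) / D l ((Suc n + 1) div 2) n)"
  proof (cases "even n")
    case True
    then obtain e where "n = 2 * e" by blast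
    then show ?thesis by (simp add: N_def)
  next
    case False
    then obtain e where e: "n = 2 * e + 1" by (elim oddE)
    have "D l (Suc e) n = (l - of_nat n) * D l (Suc (Suc e)) n"
      unfolding D_def using e by (subst prod.atLeast_Suc_atMost) (simp_all add: algebra_simps)
    with e show ?thesis using \<open>l - of_nat n \<noteq> 0\<close> D0 by simp
  qed
  finally have "H_value (Suc n) l = N l (Suc n div 2) / D l ((Suc n + 1) div 2) n"
    unfolding mult_cancel_left using \<open>l - of_nat n \<noteq> 0\<close> by blast
  then show ?case by (simp add: N_def D_def)
qed

definition disc_formula :: "nat \<Rightarrow> complex \<Rightarrow> complex \<Rightarrow> complex" where
  "disc_formula d a l = a ^ (d * (d - 1)) *
          (((\<Prod>k=1..d. of_nat k ^ k) * (\<Prod>k=1..d div 2 - 1. (l - 2 * of_nat k) ^ (2 * k))) /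
           (\<Prod>k=(d + 1) div 2..d - 1. (l - 2 * of_nat k + 1) ^ (2 * k - 1)))"

text \<open>The closed formula obeys the recursion of \<open>poly_disc_of_pderiv\<close> with c = -1
  / (l - n). Passing from l - 2 to l shifts the index k by one, so the exponents 2 k and 2 k - 1
  must grow by 2; the square of \<open>H_value\<close> supplies exactly these factors.\<close>

lemma disc_formula_Suc:
  assumes "l \<notin> \<int>" "n \<ge> 1"
  shows "disc_formula (Suc n) a l =
    of_nat (Suc n) ^ Suc n / (l - of_nat n) ^ n * a ^ (2 * n) * (H_value n (l - 2))\<^sup>2 * disc_formula n a (l - 2)"
proof -
  define N where "N x m = (\<Prod>k=1..m. (x - 2 * of_nat k) ^ (2 * k))" for x :: complex and m :: nat
  define D where "D x r s = (\<Prod>k=r..s. (x - 2 * of_nat k + 1) ^ (2 * k - 1))" for x :: complex and r s :: nat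
  define N1 where "N1 m = (\<Prod>k<m. l - 2 - 2 * of_nat k)" for m :: nat
  define D1 where "D1 r s = (\<Prod>k=r..s. l - 2 - 2 * of_nat k + 1)" for r s :: nat
  define K where "K = (\<Prod>k=1..n. of_nat k ^ k :: complex)"
  have l2: "l - 2 \<notin> \<int>" using assms by (metis Ints_add Ints_numeral diff_add_cancel)
  have N: "N l m = (N1 m)\<^sup>2 * N (l - 2) (m - 1)" for m
  proof -
    have "N l m = (\<Prod>k<m. (l - 2 - 2 * of_nat k) ^ (2 + 2 * k))"
      unfolding N_def One_nat_def prod.atLeast1_atMost_eq
      by (intro prod.cong refl arg_cong2[where f = power]) simp_all
    moreover have "N (l - 2) (m - 1) = (\<Prod>k<m. (l - 2 - 2 * of_nat k) ^ (2 * k))"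
      unfolding N_def by (cases m) (simp_all add: prod.atLeast1_atMost_eq[folded One_nat_def] prod.lessThan_Suc_shift del: prod.lessThan_Suc One_nat_def)
    ultimately show ?thesis by (simp only: N1_def prod_power_distrib prod.distrib[symmetric] power_add)
  qed
  have D: "D l (Suc r) (Suc s) = (D1 r s)\<^sup>2 * D (l - 2) r s" if "r \<ge> 1" for r s
    unfolding D_def D1_def prod.shift_bounds_cl_Suc_ivl prod_power_distrib prod.distrib[symmetric]
  proof (rule prod.cong)
    fix k assume "k \<in> {r..s}"
    then have "2 * Suc k - 1 = 2 + (2 * k - 1)" using that by simp
    then show "(l - 2 * of_nat (Suc k) + 1) ^ (2 * Suc k - 1) = (l - 2 - 2 * of_nat k + 1)\<^sup>2 * (l - 2 - 2 * of_nat k + 1) ^ (2 * k - 1)"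
      unfolding power_add[symmetric] by (simp add: algebra_simps)
  qed simp
  have nz: "l - of_nat n \<noteq> 0" using nonint_diff_of_nat[OF assms(1)] .
  have H: "H_value n (l - 2) = N1 (n div 2) / D1 ((n + 1) div 2) (n - 1)"
    using H_value_closed[OF l2 assms(2)] by (simp add: N1_def D1_def)
  have F: "disc_formula n a (l - 2) = a ^ (n * (n - 1)) * (K * N (l - 2) (n div 2 - 1) / D (l - 2) ((n + 1) div 2) (n - 1))"
    by (simp add: disc_formula_def K_def N_def D_def)
  have "of_nat (Suc n) ^ Suc n / (l - of_nat n) ^ n * a ^ (2 * n) * (H_value n (l - 2))\<^sup>2 * disc_formula n a (l - 2)
    = (a ^ (2 * n) * a ^ (n * (n - 1))) * (K * of_nat (Suc n) ^ Suc n) * 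
      (((N1 (n div 2))\<^sup>2 * N (l - 2) (n div 2 - 1)) / ((D1 ((n + 1) div 2) (n - 1))\<^sup>2 * D (l - 2) ((n + 1) div 2) (n - 1))) / (l - of_nat n) ^ n"
    unfolding H F
    by (simp only: power_divide times_divide_eq_right times_divide_eq_left divide_divide_eq_left ac_simps)
  also have "a ^ (2 * n) * a ^ (n * (n - 1)) = a ^ (Suc n * n)"
  proof -
    have "2 * n + n * (n - 1) = Suc n * n" by (cases n) simp_all
    then show ?thesis unfolding power_add[symmetric] by (simp only:)
  qed
  also have "K * of_nat (Suc n) ^ Suc n = (\<Prod>k=1..Suc n. of_nat k ^ k)"
    by (simp add: K_def prod.nat_ivl_Suc' mult.commute del: of_nat_Suc power_Suc)
  also have "(N1 (n div 2))\<^sup>2 * N (l - 2) (n div 2 - 1) = N l (n div 2)" by (simp add: N)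
  also have "(D1 ((n + 1) div 2) (n - 1))\<^sup>2 * D (l - 2) ((n + 1) div 2) (n - 1) = D l (Suc ((n + 1) div 2)) n"
    using D[of "(n + 1) div 2" "n - 1"] assms(2) by simp
  \<comment> \<open>As in \<open>H_value_closed\<close>, the power of l - n cancels the last factor
    of \<open>N\<close> for even n and becomes the first factor of \<open>D\<close> for odd
    n.\<close>
  also have "a ^ (Suc n * n) * (\<Prod>k=1..Suc n. of_nat k ^ k) * (N l (n div 2) / D l (Suc ((n + 1) div 2)) n) / (l - of_nat n) ^ n
      = a ^ (Suc n * n) * (\<Prod>k=1..Suc n. of_nat k ^ k) * (N l (Suc n div 2 - 1) / D l ((Suc n + 1) div 2) n)"
  proof (cases "even n")
    case True
    then obtain e where e: "n = 2 * e" by blast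
    obtain e' where e': "e = Suc e'" using e assms(2) by (cases e) auto
    have "N l e = N l (e - 1) * (l - of_nat n) ^ n"
      by (simp add: N_def e e' prod.nat_ivl_Suc' mult.commute)
    then show ?thesis using e nz by simp
  next
    case False
    then obtain e where e: "n = 2 * e + 1" by (elim oddE)
    have "D l (Suc e) n = (l - of_nat n) ^ n * D l (Suc (Suc e)) n"
      unfolding D_def using e by (subst prod.atLeast_Suc_atMost) (simp_all add: algebra_simps)
    then show ?thesis using e nz by simp
  qed
  finally show ?thesis by (simp add: disc_formula_def N_def D_def)
qed

text \<open>Non-integrality is inherited by l - 2 and keeps l - n away from 0 at every level of the
  induction; an integral parameter could make one of these divisors vanish.\<close>

lemma poly_disc_G_poly_nonint:
  assumes "n \<ge> 1" "l \<notin> \<int>"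
  shows "poly_disc (G_poly n a l) = disc_formula n a l"
  using assms
proof (induction n arbitrary: l rule: nat_induct_at_least)
  case base
  obtain xs where xs: "G_poly 1 a l = (\<Prod>x\<leftarrow>xs. [:- x, 1:])" "length xs = 1"
    using monic_complex_poly_roots[of "G_poly 1 a l"] by (metis coeff_G_poly_degree degree_G_poly)
  show ?case unfolding xs(1) poly_disc_roots by (simp add: disc_formula_def root_disc_def xs(2))
next
  case (Suc n)
  have l2: "l - 2 \<notin> \<int>" using Suc.prems by (metis Ints_add Ints_numeral diff_add_cancel)
  have nz: "l - of_nat n \<noteq> 0" using nonint_diff_of_nat[OF Suc.prems] .
  let ?Q = "G_poly n a (l - 2)"
  have "poly_disc (G_poly (Suc n) a l) = (-1) ^ n * of_nat (Suc n) ^ Suc n * (- 1 / (l - of_nat n)) ^ n *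
      (poly ?Q (a * \<i>) * poly ?Q (- (a * \<i>))) * poly_disc ?Q"
  proof (rule poly_disc_of_pderiv)
    fix y assume "poly ?Q y = 0"
    then show "poly (G_poly (Suc n) a l) y = - 1 / (l - of_nat n) * (y\<^sup>2 + a\<^sup>2) * poly (pderiv ?Q) y"
      using G_poly_ode_Suc[OF nonsingular_nonint[OF Suc.prems], of y a n] nz
      by (simp add: field_simps add_eq_0_iff)
  qed (simp_all only: degree_G_poly coeff_G_poly_degree pderiv_G_poly)
  also have "poly ?Q (a * \<i>) * poly ?Q (- (a * \<i>)) = (a * \<i> * (- (a * \<i>))) ^ n * (H_value n (l - 2))\<^sup>2"
  proof -
    have "(a * \<i>)\<^sup>2 = - (a\<^sup>2)" "(- (a * \<i>))\<^sup>2 = - (a\<^sup>2)"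
      by (simp_all add: power_mult_distrib)
    then show ?thesis
      by (simp only: poly_G_poly_imag power_mult_distrib power2_eq_square ac_simps)
  qed
  also have "a * \<i> * (- (a * \<i>)) = a\<^sup>2" by (simp add: power2_eq_square algebra_simps)
  also have "(-1) ^ n * of_nat (Suc n) ^ Suc n * (- 1 / (l - of_nat n)) ^ n = of_nat (Suc n) ^ Suc n / (l - of_nat n) ^ n"
  proof -
    have "(-1) ^ n * z * (- 1 / w) ^ n = z * (- 1 * (- 1 / w)) ^ n" for z w :: complex
      by (simp only: power_mult_distrib ac_simps)
    moreover have "- 1 * (- 1 / w) = 1 / w" for w :: complex by simp
    ultimately show ?thesis by (simp only: power_one_over) simp
  qed
  finally show ?case unfolding disc_formula_Suc[OF Suc.prems Suc.hyps] Suc.IH[OF l2] power_mult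
    by (simp only: ac_simps)
qed

subsection \<open>Continuity in the parameter\<close>

text \<open>A Cauchy bound: for |z| > 1 the lower terms amount to at most d B |z|^(d - 1), which
  cannot balance z^d once |z| > d B.\<close>

lemma monic_root_bound:
  fixes f :: "complex poly"
  assumes f: "lead_coeff f = 1" "poly f z = 0" and B: "\<And>i. i < degree f \<Longrightarrow> cmod (coeff f i) \<le> B"
  shows "cmod z \<le> max 1 (of_nat (degree f) * B)"
proof (rule ccontr)
  assume "\<not> ?thesis"
  then have z: "cmod z > 1" "cmod z > of_nat (degree f) * B" by auto
  obtain n where n: "degree f = Suc n"
    using f by (cases "degree f") (auto elim: degree_eq_zeroE)
  have "0 \<le> B" by (rule order_trans[OF norm_ge_zero B[of 0]]) (simp add: n)
  have "z ^ Suc n = - (\<Sum>i<Suc n. coeff f i * z ^ i)"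
    using f n unfolding poly_altdef by (simp add: lessThan_Suc_atMost[symmetric] add_eq_0_iff2)
  then have "cmod z ^ Suc n = cmod (\<Sum>i<Suc n. coeff f i * z ^ i)"
    by (simp only: norm_power[symmetric] norm_minus_cancel)
  also have "\<dots> \<le> (\<Sum>i<Suc n. B * cmod z ^ n)"
  proof (rule sum_norm_le)
    fix i assume "i \<in> {..<Suc n}"
    then have "cmod (coeff f i) \<le> B" "cmod z ^ i \<le> cmod z ^ n"
      using B n z(1) by (auto intro: power_increasing)
    then show "cmod (coeff f i * z ^ i) \<le> B * cmod z ^ n"
      unfolding norm_mult norm_power using \<open>0 \<le> B\<close> by (intro mult_mono) auto
  qed
  also have "\<dots> = (of_nat (degree f) * B) * cmod z ^ n" by (simp add: n)
  also have "\<dots> < cmod z * cmod z ^ n" 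
  proof (rule mult_strict_right_mono)
    show "0 < cmod z ^ n" using z(1) by (intro zero_less_power) linarith
  qed (use z in simp)
  finally show False by simp
qed

text \<open>Bolzano-Weierstrass for d coordinates at once, refining the subsequence one coordinate
  at a time.\<close>

lemma bounded_imp_convergent_subsequence_finite:
  fixes r :: "nat \<Rightarrow> nat \<Rightarrow> complex"
  assumes "\<And>m k. k < d \<Longrightarrow> cmod (r m k) \<le> R"
  shows "\<exists>s l. strict_mono s \<and> (\<forall>k<d. (\<lambda>m. r (s m) k) \<longlonglongrightarrow> l k)"
  using assms
proof (induction d)
  case 0
  show ?case by (intro exI[of _ id]) (simp add: strict_mono_def)
next
  case (Suc d)
  then obtain s l where s: "strict_mono s" "\<And>k. k < d \<Longrightarrow> (\<lambda>m. r (s m) k) \<longlonglongrightarrow> l k"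
    by (meson less_SucI)
  have "seq_compact (cball (0 :: complex) R)" by (intro compact_imp_seq_compact compact_cball)
  moreover have "\<forall>m. r (s m) d \<in> cball 0 R" using Suc.prems by simp
  ultimately obtain l' s' where s': "strict_mono s'" "((\<lambda>m. r (s m) d) \<circ> s') \<longlonglongrightarrow> l'"
    by (rule seq_compactE)
  have "(\<lambda>m. r ((s \<circ> s') m) k) \<longlonglongrightarrow> (l(d := l')) k"
    if "k < Suc d" for k
  proof (cases "k = d")
    case False
    then show ?thesis using LIMSEQ_subseq_LIMSEQ[OF s(2)[of k] s'(1)] that by (simp add: o_def)
  qed (use s' in \<open>simp add: o_def\<close>)
  then show ?case using s(1) s'(1) by (meson strict_mono_o)
qed

text \<open>The roots are bounded, so along a subsequence they converge to the roots of the limit. This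
  replaces an expression of the discriminant as a polynomial in the coefficients.\<close>

lemma poly_disc_tendsto:
  fixes g :: "complex poly"
  assumes f: "\<And>m. degree (f m) = d" "\<And>m. lead_coeff (f m) = 1" and g: "degree g = d"
    and lim: "\<And>i. (\<lambda>m. coeff (f m) i) \<longlonglongrightarrow> coeff g i" and L: "(\<lambda>m. poly_disc (f m)) \<longlonglongrightarrow> L"
  shows "poly_disc g = L"
proof -
  have "\<exists>xs. f m = (\<Prod>x\<leftarrow>xs. [:- x, 1:]) \<and> length xs = d" for m
    using monic_complex_poly_roots[of "f m"] f by metis
  then obtain xs where xs: "\<And>m. f m = (\<Prod>x\<leftarrow>xs m. [:- x, 1:])" "\<And>m. length (xs m) = d"
    by metis
  define r where "r m k = xs m ! k" for m k
  have "\<exists>b. \<forall>m. cmod (coeff (f m) i) \<le> b" for i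
    using convergent_imp_Bseq[OF convergentI[OF lim[of i]]] by (auto simp: Bseq_def)
  then obtain B where B: "\<And>m i. cmod (coeff (f m) i) \<le> B i" by metis
  define R where "R = max 1 (of_nat d * (\<Sum>i<d. B i))"
  have B0: "0 \<le> B i" for i using B[of 0 i] norm_ge_zero order_trans by blast
  have "cmod (r m k) \<le> R" if "k < d" for m k
  proof -
    have "poly (f m) (r m k) = 0"
      using that xs by (auto simp: r_def poly_prod_list_roots prod_list_zero_iff)
    then have "cmod (r m k) \<le> max 1 (of_nat (degree (f m)) * (\<Sum>i<d. B i))"
    proof (intro monic_root_bound f)
      fix i assume "i < degree (f m)"
      then have "B i \<le> (\<Sum>i<d. B i)" using f B0 by (intro member_le_sum) auto
      then show "cmod (coeff (f m) i) \<le> (\<Sum>i<d. B i)" using B order_trans by blast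
    qed
    then show ?thesis by (simp add: R_def f)
  qed
  then obtain s l where s: "strict_mono s" "\<And>k. k < d \<Longrightarrow> (\<lambda>m. r (s m) k) \<longlonglongrightarrow> l k"
    using bounded_imp_convergent_subsequence_finite[of d r R] by blast
  have "poly g z = poly (\<Prod>x\<leftarrow>map l [0..<d]. [:- x, 1:]) z" for z
  proof -
    have "poly (f (s m)) z = (\<Prod>k<d. z - r (s m) k)" for m
      unfolding xs(1) poly_prod_list_roots
        by (simp add: xs(2) r_def prod.list_conv_set_nth atLeast0LessThan)
    moreover have "(\<lambda>m. \<Prod>k<d. z - r (s m) k) \<longlonglongrightarrow> (\<Prod>k<d. z - l k)"
      using s(2) by (intro tendsto_intros) auto
    ultimately have "(\<lambda>m. poly (f (s m)) z) \<longlonglongrightarrow> (\<Prod>k<d. z - l k)"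
      by simp
    moreover have "(\<lambda>m. poly (f m) z) \<longlonglongrightarrow> poly g z"
      unfolding poly_altdef f(1) g by (intro tendsto_intros lim)
    then have "(\<lambda>m. poly (f (s m)) z) \<longlonglongrightarrow> poly g z"
      using LIMSEQ_subseq_LIMSEQ[OF _ s(1)] by (auto simp: o_def)
    ultimately have "poly g z = (\<Prod>k<d. z - l k)" using LIMSEQ_unique by blast
    then show ?thesis
      unfolding poly_prod_list_roots by (simp add: prod.list_conv_set_nth atLeast0LessThan)
  qed
  then have "g = (\<Prod>x\<leftarrow>map l [0..<d]. [:- x, 1:])"
    unfolding poly_eq_poly_eq_iff[symmetric] by (intro ext)
  from poly_disc_eq[OF this] have "poly_disc g = (\<Prod>k<d. \<Prod>j<k. (l j - l k)\<^sup>2)"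
    by simp
  moreover have "(\<lambda>m. poly_disc (f (s m))) \<longlonglongrightarrow> (\<Prod>k<d. \<Prod>j<k. (l j - l k)\<^sup>2)"
    unfolding xs poly_disc_roots root_disc_def using s(2)
    by (intro tendsto_intros) (auto simp flip: r_def)
  \<comment> \<open>The whole sequence of discriminants is assumed to converge, so the subsequence
    chosen for the roots identifies its limit.\<close>
  moreover have "(\<lambda>m. poly_disc (f (s m))) \<longlonglongrightarrow> L"
    using LIMSEQ_subseq_LIMSEQ[OF L s(1)] by (simp add: o_def)
  ultimately show ?thesis using LIMSEQ_unique by metis
qed

lemma nonsingular_iff:
  assumes "d \<ge> 1"
  shows "l \<notin> {2 * of_nat k - 1 | k. (d + 1) div 2 \<le> k \<and> k \<le> d - 1} \<longleftrightarrow> nonsingular d l"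
proof -
  have "l \<in> {2 * of_nat k - 1 | k. (d + 1) div 2 \<le> k \<and> k \<le> d - 1} \<longleftrightarrow>
      (\<exists>j\<in>{1..d div 2}. l - 2 * of_nat d + 2 * of_nat j + 1 = 0)"
  proof
    assume "l \<in> {2 * of_nat k - 1 | k. (d + 1) div 2 \<le> k \<and> k \<le> d - 1}"
    then obtain k where "l = 2 * of_nat k - 1" "(d + 1) div 2 \<le> k" "k \<le> d - 1" by blast
    then show "\<exists>j\<in>{1..d div 2}. l - 2 * of_nat d + 2 * of_nat j + 1 = 0"
      using assms by (intro bexI[of _ "d - k"]) (auto simp: of_nat_diff)
  next
    assume "\<exists>j\<in>{1..d div 2}. l - 2 * of_nat d + 2 * of_nat j + 1 = 0"
    then obtain j where "l - 2 * of_nat d + 2 * of_nat j + 1 = 0" "1 \<le> j" "j \<le> d div 2"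
      by auto
    then show "l \<in> {2 * of_nat k - 1 | k. (d + 1) div 2 \<le> k \<and> k \<le> d - 1}"
      by (intro CollectI exI[of _ "d - j"]) (auto simp: of_nat_diff algebra_simps add_eq_0_iff)
  qed
  then show ?thesis by (auto simp: nonsingular_def)
qed

lemma poly_disc_G_poly:
  assumes "d \<ge> 1" and l: "nonsingular d l"
  shows "poly_disc (G_poly d a l) = disc_formula d a l"
proof (cases "l \<in> \<int>")
  case False
  then show ?thesis using poly_disc_G_poly_nonint assms by blast
next
  case True
  \<comment> \<open>For integral \<open>l\<close> these parameters are not integers, since the
    offset lies strictly between 0 and 1; this is why the denominator starts at 2.\<close>
  define e where "e m = l + of_real (1 / real (m + 2))" for m :: nat
  have e: "e m \<notin> \<int>" for m
  proof
    assume "e m \<in> \<int>"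
    then have "complex_of_real (1 / real (m + 2)) \<in> \<int>" using True unfolding e_def
      by (metis Ints_diff add_diff_cancel_left')
    then obtain k where "complex_of_real (1 / real (m + 2)) = of_int k" by (elim Ints_cases)
    then have "1 / real (m + 2) = of_int k" by (metis of_real_eq_iff of_real_of_int_eq)
    moreover have "0 < 1 / real (m + 2)" "1 / real (m + 2) < 1" by simp_all
    ultimately have "0 < k" "k < 1" by auto
    then show False by simp
  qed
  have elim: "e \<longlonglongrightarrow> l"
  proof -
    have "(\<lambda>m. 1 / real (m + 2)) \<longlonglongrightarrow> 0"
      by (rule LIMSEQ_ignore_initial_segment[OF lim_1_over_n])
    then have "(\<lambda>m. l + of_real (1 / real (m + 2))) \<longlonglongrightarrow> l + of_real 0"
      by (intro tendsto_intros)
    then show ?thesis by (simp add: e_def[abs_def])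
  qed
  show ?thesis
  proof (rule poly_disc_tendsto)
    show "(\<lambda>m. coeff (G_poly d a (e m)) i) \<longlonglongrightarrow> coeff (G_poly d a l) i" for i
    proof (cases "i \<le> d \<and> even (d - i)")
      case True
      have "(\<lambda>m. G_coeff d a (e m) ((d - i) div 2)) \<longlonglongrightarrow> G_coeff d a l ((d - i) div 2)"
        unfolding G_coeff_def using l True
        by (intro tendsto_intros elim) (auto simp: nonsingular_def)
      then show ?thesis using True by (simp add: coeff_G_poly)
    next
      case False
      then show ?thesis unfolding coeff_G_poly by (simp only: if_False tendsto_const)
    qed
    have nz: "l - 2 * of_nat k + 1 \<noteq> 0" if "(d + 1) div 2 \<le> k" "k \<le> d - 1" for k
      using l that assms(1) unfolding nonsingular_iff[OF assms(1), symmetric]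
        by (auto simp: algebra_simps)
    have "(\<lambda>m. disc_formula d a (e m)) \<longlonglongrightarrow> disc_formula d a l"
      unfolding disc_formula_def by (intro tendsto_intros elim) (use nz in \<open>auto\<close>)
    then show "(\<lambda>m. poly_disc (G_poly d a (e m))) \<longlonglongrightarrow> disc_formula d a l"
      using poly_disc_G_poly_nonint[OF assms(1) e] by simp
  qed simp_all
qed

subsection \<open>Real-rootedness\<close>

lemma pderiv_prod_roots:
  fixes y :: "'b \<Rightarrow> 'a :: field"
  assumes "finite K" "\<And>k. k \<in> K \<Longrightarrow> z \<noteq> y k"
  shows "poly (pderiv (\<Prod>k\<in>K. [:- y k, 1:])) z = (\<Prod>k\<in>K. z - y k) * (\<Sum>k\<in>K. 1 / (z - y k))"
  using assms
proof (induction K rule: finite_induct)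
  case (insert k K)
  then have "z - y k \<noteq> 0" by simp
  then show ?case
  proof -
    have "X + u * (X * S) = u * X * (1 / u + S)" if "u \<noteq> 0" for X u S :: 'a
      using that by (simp add: field_simps)
    from this[OF \<open>z - y k \<noteq> 0\<close>] show ?thesis
      using insert unfolding prod.insert[OF insert(1,2)] sum.insert[OF insert(1,2)] pderiv_linear_mult
      by (simp add: poly_prod)
  qed
qed simp

lemma pderiv2_at_root:
  "poly (pderiv (pderiv ([:- z, 1:] * p))) z = 2 * poly (pderiv p) z"
  for z :: "'a :: field"
  unfolding pderiv_mult pderiv_add by (simp add: pderiv_pCons)

lemma prod_list_roots_nth: "(\<Prod>x\<leftarrow>xs. [:- x, 1:]) = (\<Prod>k<length xs. [:- (xs ! k), 1 :: 'a :: comm_ring_1:])"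
  by (simp add: prod.list_conv_set_nth atLeast0LessThan)

text \<open>For real u, (z^2 + a^2) / (z - u) = z + u + (u^2 + a^2) / (z - u), and the imaginary
  part of 1 / (z - u) is - Im z / |z - u|^2.\<close>

lemma Im_sum_inverse_diff:
  fixes y :: "'b \<Rightarrow> real"
  assumes "Im z \<noteq> 0"
  shows "Im ((z\<^sup>2 + (of_real a)\<^sup>2) * (\<Sum>k\<in>K. 1 / (z - of_real (y k)))) =
    Im z * (real (card K) - (\<Sum>k\<in>K. ((y k)\<^sup>2 + a\<^sup>2) / (cmod (z - of_real (y k)))\<^sup>2))"
proof -
  have "Im ((z\<^sup>2 + (of_real a)\<^sup>2) / (z - of_real u)) = Im z * (1 - (u\<^sup>2 + a\<^sup>2) / (cmod (z - of_real u))\<^sup>2)" for u :: real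
  proof -
    have nz: "z - of_real u \<noteq> 0" using assms by (auto simp: complex_eq_iff)
    then have "(z\<^sup>2 + (of_real a)\<^sup>2) / (z - of_real u) = z + of_real u + of_real (u\<^sup>2 + a\<^sup>2) / (z - of_real u)"
      by (simp add: divide_simps) (simp add: algebra_simps power2_eq_square)
    then show ?thesis
      by (simp add: Im_divide' add_divide_distrib diff_divide_distrib algebra_simps)
  qed
  note 1 = this
  have "(z\<^sup>2 + (of_real a)\<^sup>2) * (\<Sum>k\<in>K. 1 / (z - of_real (y k))) =
      (\<Sum>k\<in>K. (z\<^sup>2 + (of_real a)\<^sup>2) / (z - of_real (y k)))"
    unfolding sum_distrib_left by simp
  then show ?thesis
    unfolding right_diff_distrib sum_distrib_left by (simp add: 1 sum_subtractf right_diff_distrib)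
qed

lemma real_roots_list:
  fixes f :: "complex poly"
  assumes "lead_coeff f = 1" "\<And>z. poly f z = 0 \<Longrightarrow> z \<in> \<real>"
  obtains ys :: "real list" where "f = (\<Prod>k<length ys. [:- of_real (ys ! k), 1:])" "length ys = degree f" "sorted ys"
proof -
  obtain xs where xs: "f = (\<Prod>x\<leftarrow>xs. [:- x, 1:])" "length xs = degree f" "mset xs = proots f"
    using monic_complex_poly_roots[OF assms(1)] by blast
  define ys where "ys = sort (map Re xs)"
  have "x \<in> \<real>" if "x \<in> set xs" for x
    using that assms(2)[of x] by (auto simp: xs(1) poly_prod_list_roots prod_list_zero_iff)
  then have re: "map (\<lambda>x. of_real (Re x)) xs = xs" by (intro map_idI) simp
  have "mset (map of_real ys) = mset (map (\<lambda>x. complex_of_real (Re x)) xs)"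
    by (simp add: ys_def image_mset.compositionality o_def)
  then have m: "mset (map of_real ys) = mset xs" unfolding re .
  have "prod_mset (image_mset (\<lambda>x. [:- x, 1:]) (mset (map complex_of_real ys))) = f"
    unfolding m by (simp add: xs(1) prod_mset_prod_list flip: mset_map)
  then have "f = (\<Prod>x\<leftarrow>map complex_of_real ys. [:- x, 1:])"
    by (simp add: prod_mset_prod_list flip: mset_map)
  then have "f = (\<Prod>k<length ys. [:- of_real (ys ! k), 1:])"
    unfolding prod_list_roots_nth by simp
  then show ?thesis using that xs(2) by (simp add: ys_def)
qed

lemma nonsingular_of_real:
  assumes "l \<ge> 2 * real d - 2"
  shows "nonsingular d (of_real l)"
  unfolding nonsingular_def
proof
  fix j assume "j \<in> {1..d div 2}"
  then have "l - 2 * real d + 2 * real j + 1 \<noteq> 0" using assms by auto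
  then have "complex_of_real (l - 2 * real d + 2 * real j + 1) \<noteq> 0"
    unfolding of_real_eq_0_iff .
  then show "of_real l - 2 * of_nat d + 2 * of_nat j + 1 \<noteq> (0 :: complex)" by simp
qed

text \<open>Let \<open>Q\<close> have the real roots \<open>y\<^sub>1, \<dots>, y\<^sub>n\<close>. If \<open>Im z \<noteq> 0\<close>, the differential equation gives
  \<open>Im ((l - n) P z / Q z) = Im z * (l - n + (\<Sum>k. (y\<^sub>k\<^sup>2 + a\<^sup>2) / \<bar>z - y\<^sub>k\<bar>\<^sup>2)) \<noteq> 0\<close>.\<close>

lemma G_poly_roots_real:
  assumes "a > 0" "l \<ge> 2 * real d - 2" "poly (G_poly d (of_real a) (of_real l)) z = 0"
  shows "z \<in> \<real>"
  using assms(2,3)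
proof (induction d arbitrary: l z)
  case 0
  then show ?case by (simp add: G_poly_def)
next
  case (Suc n)
  show ?case
  proof (cases "n = 0")
    case True
    then show ?thesis using Suc.prems by (simp add: G_poly_def poly_monom)
  next
    case False
    define P where "P = G_poly (Suc n) (of_real a) (of_real l)"
    define Q where "Q = G_poly n (of_real a) (of_real l - 2)"
    \<comment> \<open>The induction applies since l - 2 is at least 2 n - 2.\<close>
    have "u \<in> \<real>" if "poly Q u = 0" for u
      using Suc.IH[of "l - 2" u] Suc.prems(1) that by (simp add: Q_def)
    then obtain ys :: "real list" where ys: "Q = (\<Prod>k<length ys. [:- of_real (ys ! k), 1:])" "length ys = n"
      using real_roots_list[of Q] by (metis Q_def degree_G_poly coeff_G_poly_degree)
    have ode: "(z\<^sup>2 + (of_real a)\<^sup>2) * poly (pderiv Q) z - of_real l * z * poly Q z + (of_real l - of_nat n) * poly P z = 0"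
      using G_poly_ode_Suc[OF nonsingular_of_real[OF Suc.prems(1)], of z "of_real a"]
        by (simp add: P_def Q_def)
    show ?thesis
    proof (rule ccontr)
      assume "z \<notin> \<real>"
      then have im: "Im z \<noteq> 0" by (simp add: complex_is_Real_iff)
      define S where "S = (\<Sum>k<n. 1 / (z - of_real (ys ! k)))"
      have zy: "z \<noteq> of_real u" for u using im by auto
      have Q0: "poly Q z \<noteq> 0" unfolding ys using zy by (simp add: poly_prod)
      have "poly (pderiv Q) z = poly Q z * S"
        unfolding ys S_def using pderiv_prod_roots[of "{..<n}" z "\<lambda>k. of_real (ys ! k)"] zy
          by (simp add: poly_prod)
      then have "poly Q z * ((z\<^sup>2 + (of_real a)\<^sup>2) * S) = poly Q z * (of_real l * z)"
        using ode Suc.prems(2) unfolding P_def by (simp add: algebra_simps)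
      then have "(z\<^sup>2 + (of_real a)\<^sup>2) * S = of_real l * z"
        unfolding mult_cancel_left using Q0 by blast
      then have "Im z * (real n - (\<Sum>k<n. ((ys ! k)\<^sup>2 + a\<^sup>2) / (cmod (z - of_real (ys ! k)))\<^sup>2)) = l * Im z"
        using Im_sum_inverse_diff[OF im, of a "\<lambda>k. ys ! k" "{..<n}"] by (auto simp: S_def)
      \<comment> \<open>The left-hand side is at most n, whereas l is at least 2 n > n.\<close>
      then have "real n - (\<Sum>k<n. ((ys ! k)\<^sup>2 + a\<^sup>2) / (cmod (z - of_real (ys ! k)))\<^sup>2) = l"
        using im by simp
      moreover have "(\<Sum>k<n. ((ys ! k)\<^sup>2 + a\<^sup>2) / (cmod (z - of_real (ys ! k)))\<^sup>2) \<ge> 0"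
        by (intro sum_nonneg) simp
      ultimately show False using Suc.prems(1) False by simp
    qed
  qed
qed

section \<open>Tangent inequalities and sums over pairs\<close>

text \<open>The derivative - tan is strictly decreasing, so the mean value theorem places the graph
  strictly below its tangents.\<close>

lemma ln_cos_less_tangent:
  assumes "u \<in> {- (pi / 2)<..<pi / 2}" "v \<in> {- (pi / 2)<..<pi / 2}" "u \<noteq> v"
  shows "ln (cos u) < ln (cos v) - tan v * (u - v)"
proof -
  have der: "((\<lambda>x. ln (cos x)) has_real_derivative - tan x) (at x)"
    if "x \<in> {- (pi / 2)<..<pi / 2}" for x
  proof -
    have "cos x > 0" using that by (intro cos_gt_zero_pi) auto
    then show ?thesis by (auto intro!: derivative_eq_intros simp: tan_def)
  qed
  show ?thesis
  proof (cases "u < v")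
    case True
    then obtain z where z: "u < z" "z < v" "ln (cos v) - ln (cos u) = (v - u) * - tan z"
      using MVT2[OF True, of "\<lambda>x. ln (cos x)" "\<lambda>x. - tan x"] der assms by force
    moreover have "tan z < tan v" using z assms by (intro tan_monotone) auto
    then have "(v - u) * tan z < (v - u) * tan v" using True by (intro mult_strict_left_mono) auto
    ultimately show ?thesis by (simp add: algebra_simps)
  next
    case False
    then have "v < u" using assms by simp
    then obtain z where z: "v < z" "z < u" "ln (cos u) - ln (cos v) = (u - v) * - tan z"
      using MVT2[of v u "\<lambda>x. ln (cos x)" "\<lambda>x. - tan x"] der assms by force
    moreover have "tan v < tan z" using z assms by (intro tan_monotone) auto
    then have "(u - v) * tan v < (u - v) * tan z"
      using \<open>v < u\<close> by (intro mult_strict_left_mono) auto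
    ultimately show ?thesis by (simp add: algebra_simps)
  qed
qed

lemma ln_sin_less_tangent:
  assumes "u \<in> {0<..<pi}" "v \<in> {0<..<pi}" "u \<noteq> v"
  shows "ln (sin u) < ln (sin v) + cot v * (u - v)"
proof -
  have "ln (cos (u - pi / 2)) < ln (cos (v - pi / 2)) - tan (v - pi / 2) * ((u - pi / 2) - (v - pi / 2))"
    using assms by (intro ln_cos_less_tangent) auto
  moreover have "cos (x - pi / 2) = sin x" "tan (x - pi / 2) = - cot x" for x :: real
    by (simp_all add: cos_diff sin_diff tan_def cot_def)
  ultimately show ?thesis by simp
qed

text \<open>A pair contributes \<open>c k j * e k + c j k * e j\<close>. Regrouping by the index of
  \<open>e\<close> produces, for each root, the sum over all other roots that the critical point
  equation controls.\<close>

lemma sum_pairs_antisym: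
  fixes c :: "nat \<Rightarrow> nat \<Rightarrow> real"
  assumes "\<And>j k. c j k = - c k j"
  shows "(\<Sum>k<d. \<Sum>j<k. c k j * (e k - e j)) = (\<Sum>k<d. e k * (\<Sum>j\<in>{..<d} - {k}. c k j))"
proof (induction d)
  case (Suc d)
  have "(\<Sum>k<d. e k * (\<Sum>j\<in>{..<Suc d} - {k}. c k j)) = (\<Sum>k<d. e k * (\<Sum>j\<in>{..<d} - {k}. c k j) - c d k * e k)"
  proof (rule sum.cong)
    fix k assume "k \<in> {..<d}"
    then have "{..<Suc d} - {k} = insert d ({..<d} - {k})" by auto
    then have eq: "(\<Sum>j\<in>{..<Suc d} - {k}. c k j) = c k d + (\<Sum>j\<in>{..<d} - {k}. c k j)"
      by (simp only:) (subst sum.insert, auto)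
    then show "e k * (\<Sum>j\<in>{..<Suc d} - {k}. c k j) = e k * (\<Sum>j\<in>{..<d} - {k}. c k j) - c d k * e k"
      unfolding eq assms[of k d] by (simp add: algebra_simps)
  qed simp
  moreover have "{..<Suc d} - {d} = {..<d}" by auto
  ultimately show ?case using Suc.IH by (simp add: sum_subtractf sum_distrib_left algebra_simps)
qed simp

lemma sum_pairs_add:
  fixes c :: "nat \<Rightarrow> real"
  shows "(\<Sum>k<d. \<Sum>j<k. c j + c k) = (real d - 1) * (\<Sum>k<d. c k)"
  by (induction d) (simp_all add: sum.distrib algebra_simps)

subsection \<open>Concavity\<close>

lemma arctan_diff_cos_sin:
  fixes p q :: real
  shows "sin (arctan p - arctan q) = cos (arctan p) * cos (arctan q) * (p - q)"
    and "cos (arctan p - arctan q) = cos (arctan p) * cos (arctan q) * (1 + p * q)"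
proof -
  have "sin (arctan x) = cos (arctan x) * x" for x :: real
    using tan_arctan[of x] cos_arctan_not_zero[of x] by (simp add: tan_def field_simps)
  then show "sin (arctan p - arctan q) = cos (arctan p) * cos (arctan q) * (p - q)"
    and "cos (arctan p - arctan q) = cos (arctan p) * cos (arctan q) * (1 + p * q)"
    by (simp_all add: sin_diff cos_diff algebra_simps)
qed

lemma cos_arctan_pos: "0 < cos (arctan x)"
  using arctan_bounded[of x] by (intro cos_gt_zero_pi) auto

text \<open>Translates the terms 1 / (y_j - y_k) of the critical point equation into angles, using
  the addition theorems and a^2 + y_j y_k = (y_j^2 + a^2) - y_j (y_j - y_k).\<close>

lemma cot_arctan_diff:
  fixes y :: "nat \<Rightarrow> real"
  assumes "a > 0" "y j \<noteq> y k"
  shows "cot (arctan (y j / a) - arctan (y k / a)) = ((y j)\<^sup>2 + a\<^sup>2) / a * (1 / (y j - y k)) - y j / a"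
proof -
  have "cot (arctan (y j / a) - arctan (y k / a)) = (1 + (y j / a) * (y k / a)) / (y j / a - y k / a)"
    unfolding cot_def arctan_diff_cos_sin using cos_arctan_pos[of "y j / a"] cos_arctan_pos[of "y k / a"] by simp
  also have "\<dots> = (a\<^sup>2 + y j * y k) / (a * (y j - y k))"
    using assms by (simp add: field_simps power2_eq_square)
  also have "a\<^sup>2 + y j * y k = ((y j)\<^sup>2 + a\<^sup>2) - y j * (y j - y k)"
    by (simp add: power2_eq_square algebra_simps)
  finally show ?thesis using assms by (simp add: diff_divide_distrib)
qed

text \<open>The tangent inequality for \<open>ln cos\<close>, summed over the constraint, gives
  \<open>(\<Sum>k. tan s\<^sub>k * (t\<^sub>k - s\<^sub>k)) \<le> 0\<close> with equality only for \<open>t = s\<close>; the one for \<open>ln sin\<close>, summed over all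
  pairs, bounds the difference by a nonnegative multiple of this sum. In the extremal case
  \<open>l = 2 d - 2\<close> that multiple is \<open>0\<close> and a common shift of all \<open>t\<^sub>k\<close> costs nothing in the pair
  inequalities; it is excluded by \<open>\<Sum>k. tan s\<^sub>k = 0\<close>.\<close>

lemma log_discriminant_le:
  fixes x y :: "nat \<Rightarrow> real"
  assumes a: "a > 0" and d: "d \<ge> 2" and l: "l \<ge> 2 * real d - 2"
    and x: "\<And>j k. j < k \<Longrightarrow> k < d \<Longrightarrow> x j < x k" and y: "\<And>j k. j < k \<Longrightarrow> k < d \<Longrightarrow> y j < y k"
    and crit: "\<And>j. j < d \<Longrightarrow> (\<Sum>k\<in>{..<d} - {j}. 2 / (y j - y k)) = l * y j / ((y j)\<^sup>2 + a\<^sup>2)"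
    and centred: "(\<Sum>k<d. y k) = 0"
    and prod_eq: "(\<Prod>k<d. (x k)\<^sup>2 + a\<^sup>2) = (\<Prod>k<d. (y k)\<^sup>2 + a\<^sup>2)"
  defines "V \<equiv> \<lambda>z. \<Sum>k<d. \<Sum>j<k. ln (z k - z j :: real)"
  shows "V x \<le> V y" and "V x = V y \<Longrightarrow> k < d \<Longrightarrow> x k = y k"
proof -
  define A where "A z k = arctan (z k / a)" for z and k :: nat
  define L where "L z = (\<Sum>k<d. ln (cos (A z k)))" for z
  define S where "S z = (\<Sum>k<d. \<Sum>j<k. ln (sin (A z k - A z j)))" for z
  define e where "e k = A x k - A y k" for k
  define D where "D = (\<Sum>k<d. tan (A y k) * e k)"
  have A_bounds: "A z k \<in> {- (pi / 2)<..<pi / 2}" for z k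
    using arctan_bounded[of "z k / a"] by (simp add: A_def)
  have A_diff: "A z k - A z j \<in> {0<..<pi}" if "z j < z k" for z j k
  proof -
    have "A z j < A z k" using that a by (simp add: A_def arctan_less_iff divide_strict_right_mono)
    then show ?thesis using A_bounds[of z j] A_bounds[of z k] by auto
  qed
  \<comment> \<open>Each angle lies in d - 1 pairs, hence the coefficient of
    \<open>L\<close>.\<close>
  have V: "V z = S z - (real d - 1) * L z + (\<Sum>k<d. \<Sum>j<k. ln a)"
    if z: "\<And>j k. j < k \<Longrightarrow> k < d \<Longrightarrow> z j < z k" for z
  proof -
    have "ln (z k - z j) = ln (sin (A z k - A z j)) - (ln (cos (A z j)) + ln (cos (A z k))) + ln a"
      if "j < k" "k < d" for j k
    proof -
      have "z k - z j = a * sin (A z k - A z j) / (cos (A z j) * cos (A z k))"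
        unfolding A_def arctan_diff_cos_sin using a cos_arctan_pos[of "z j / a"] cos_arctan_pos[of "z k / a"]
        by (simp add: field_simps)
      moreover have "0 < sin (A z k - A z j)"
        using A_diff[OF z[OF that]] by (intro sin_gt_zero) auto
      moreover have "0 < cos (A z j)" "0 < cos (A z k)" unfolding A_def by (rule cos_arctan_pos)+
      ultimately show ?thesis using a by (simp add: ln_div ln_mult)
    qed
    then have "V z = (\<Sum>k<d. \<Sum>j<k. ln (sin (A z k - A z j)) - (ln (cos (A z j)) + ln (cos (A z k))) + ln a)"
      unfolding V_def by (intro sum.cong) auto
    then show ?thesis
      using sum_pairs_add[of "\<lambda>k. ln (cos (A z k))" d]
        by (simp add: S_def L_def sum.distrib sum_subtractf)
  qed
  \<comment> \<open>The constraint fixes \<open>L\<close>, because cos (arctan (z / a)) = a / sqrt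
    (z^2 + a^2). Only the sine terms remain to be compared.\<close>
  have L_eq: "L x = L y"
  proof -
    have "L z = - ln (\<Prod>k<d. (z k)\<^sup>2 + a\<^sup>2) / 2 + (\<Sum>k<d. ln a)" for z
    proof -
      have "ln (cos (A z k)) = ln a - ln ((z k)\<^sup>2 + a\<^sup>2) / 2" for k
      proof -
        have pos: "(z k)\<^sup>2 + a\<^sup>2 > 0" using a by (simp add: add_nonneg_pos)
        have "1 + (z k / a)\<^sup>2 = ((z k)\<^sup>2 + a\<^sup>2) / a\<^sup>2"
          using a by (simp add: field_simps)
        then have "sqrt (1 + (z k / a)\<^sup>2) = sqrt ((z k)\<^sup>2 + a\<^sup>2) / a"
          using a by (simp add: real_sqrt_divide)
        then have "cos (A z k) = a / sqrt ((z k)\<^sup>2 + a\<^sup>2)"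
          unfolding A_def cos_arctan by simp
        then show ?thesis using a pos by (simp add: ln_div ln_sqrt)
      qed
      moreover have "ln (\<Prod>k<d. (z k)\<^sup>2 + a\<^sup>2) = (\<Sum>k<d. ln ((z k)\<^sup>2 + a\<^sup>2))"
        using a by (intro ln_prod) (auto simp: add_nonneg_pos)
      ultimately show ?thesis by (simp add: L_def sum_subtractf sum_divide_distrib)
    qed
    then show ?thesis using prod_eq by simp
  qed
  have tan_A: "tan (A y k) = y k / a" for k unfolding A_def by (rule tan_arctan)
  have cos_less: "ln (cos (A x k)) < ln (cos (A y k)) - tan (A y k) * e k" if "e k \<noteq> 0" for k
    using ln_cos_less_tangent[OF A_bounds A_bounds, of x k y k] that by (simp add: e_def)
  have cos_le: "ln (cos (A x k)) \<le> ln (cos (A y k)) - tan (A y k) * e k" for k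
    using cos_less[of k] by (cases "e k = 0") (auto simp: e_def)
  have LD: "(\<Sum>k<d. ln (cos (A y k)) - tan (A y k) * e k) = L x - D"
    unfolding L_eq by (simp add: L_def D_def sum_subtractf)
  have "L x \<le> L x - D"
    unfolding LD[symmetric] unfolding L_def using cos_le by (intro sum_mono)
  then have D_le: "D \<le> 0" by simp
  have D_less: "D < 0" if "k < d" "e k \<noteq> 0" for k
  proof -
    have "L x < L x - D"
      unfolding LD[symmetric] unfolding L_def using cos_le cos_less that
        by (intro sum_strict_mono_ex1) auto
    then show ?thesis by simp
  qed
  \<comment> \<open>The critical point equation yields l / 2 times the tangent, and the d - 1 terms
    - y_k / a subtract d - 1 times it. The resulting factor is nonnegative precisely for l >= 2 d -
    2.\<close>
  have cot_sum: "(\<Sum>j\<in>{..<d} - {k}. cot (A y k - A y j)) = (l - 2 * real d + 2) / 2 * tan (A y k)"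
    if "k < d" for k
  proof -
    have "(\<Sum>j\<in>{..<d} - {k}. cot (A y k - A y j)) =
        (\<Sum>j\<in>{..<d} - {k}. ((y k)\<^sup>2 + a\<^sup>2) / (2 * a) * (2 / (y k - y j)) - y k / a)"
    proof (intro sum.cong refl)
      fix j assume j: "j \<in> {..<d} - {k}"
      then have "y k \<noteq> y j"
        using that y[of j k] y[of k j] by (cases j k rule: linorder_cases) auto
      from cot_arctan_diff[OF a this]
      have "cot (A y k - A y j) = ((y k)\<^sup>2 + a\<^sup>2) / a * (1 / (y k - y j)) - y k / a"
        by (simp add: A_def)
      moreover have "X / a * (1 / Z) = X / (2 * a) * (2 / Z)" for X Z by simp
      ultimately show "cot (A y k - A y j) = ((y k)\<^sup>2 + a\<^sup>2) / (2 * a) * (2 / (y k - y j)) - y k / a"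
        by (simp only:)
    qed
    also have "\<dots> = ((y k)\<^sup>2 + a\<^sup>2) / (2 * a) * (\<Sum>j\<in>{..<d} - {k}. 2 / (y k - y j)) - (real d - 1) * (y k / a)"
      unfolding sum_subtractf sum_distrib_left[symmetric] using that by (simp add: of_nat_diff)
    also have "\<dots> = (l - 2 * real d + 2) / 2 * (y k / a)"
    proof -
      have "(y k)\<^sup>2 + a\<^sup>2 \<noteq> 0" using a by (simp add: sum_power2_eq_zero_iff)
      moreover have "W / (2 * a) * (l * Y / W) - (real d - 1) * (Y / a) = (l - 2 * real d + 2) / 2 * (Y / a)"
        if "W \<noteq> 0" for W Y using that a by (simp add: field_simps)
      ultimately show ?thesis unfolding crit[OF that] by blast
    qed
    finally show ?thesis by (simp add: tan_A)
  qed
  \<comment> \<open>The upper bound for \<open>S x\<close> obtained from the tangents at the angles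
    of \<open>y\<close>.\<close>
  define T where "T = (\<Sum>k<d. \<Sum>j<k. ln (sin (A y k - A y j)) + cot (A y k - A y j) * (e k - e j))"
  have T: "T = S y + (l - 2 * real d + 2) / 2 * D"
  proof -
    have "(\<Sum>k<d. \<Sum>j<k. cot (A y k - A y j) * (e k - e j)) = (\<Sum>k<d. e k * (\<Sum>j\<in>{..<d} - {k}. cot (A y k - A y j)))"
    proof (rule sum_pairs_antisym)
      fix j k show "cot (A y j - A y k) = - cot (A y k - A y j)"
        using cot_minus[of "A y k - A y j"] by simp
    qed
    also have "\<dots> = (l - 2 * real d + 2) / 2 * D"
      unfolding D_def sum_distrib_left[where A = "{..<d}"]
      by (intro sum.cong refl) (simp add: cot_sum[simplified])
    finally show ?thesis by (simp add: T_def S_def sum.distrib)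
  qed
  have pair: "ln (sin (A x k - A x j)) \<le> ln (sin (A y k - A y j)) + cot (A y k - A y j) * (e k - e j)"
    and pair_strict: "e k \<noteq> e j \<Longrightarrow> ln (sin (A x k - A x j)) < ln (sin (A y k - A y j)) + cot (A y k - A y j) * (e k - e j)"
    if "j < k" "k < d" for j k
  proof -
    have eq: "(A x k - A x j) - (A y k - A y j) = e k - e j" by (simp add: e_def)
    show *: "ln (sin (A x k - A x j)) < ln (sin (A y k - A y j)) + cot (A y k - A y j) * (e k - e j)"
      if "e k \<noteq> e j"
      using ln_sin_less_tangent[OF A_diff[OF x[OF \<open>j < k\<close> \<open>k < d\<close>]] A_diff[OF y[OF \<open>j < k\<close> \<open>k < d\<close>]]] that eq by auto
    show "ln (sin (A x k - A x j)) \<le> ln (sin (A y k - A y j)) + cot (A y k - A y j) * (e k - e j)"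
    proof (cases "e k = e j")
      case True
      then show ?thesis using eq by simp
    qed (use * in auto)
  qed
  have ST: "S x \<le> T" unfolding S_def T_def using pair by (intro sum_mono) auto
  have lD: "(l - 2 * real d + 2) / 2 * D \<le> 0" using l D_le by (intro mult_nonneg_nonpos) auto
  show "V x \<le> V y" using ST lD by (simp add: V[OF x] V[OF y] L_eq T)
  assume VV: "V x = V y" and k: "k < d"
  then have "S x = S y" by (simp add: V[OF x] V[OF y] L_eq)
  then have ST_eq: "S x = T" using ST lD by (simp add: T)
  \<comment> \<open>Comparison with index 0 suffices: one strict pair (0, k) already contradicts
    \<open>S x = T\<close>.\<close>
  have e_const: "e k = e 0" if "k < d" for k
  proof (rule ccontr)
    assume ne: "e k \<noteq> e 0"
    then have "0 < k" by (cases k) auto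
    have "S x < T" unfolding S_def T_def
    proof (rule sum_strict_mono_ex1)
      show "\<forall>k\<in>{..<d}. (\<Sum>j<k. ln (sin (A x k - A x j))) \<le> (\<Sum>j<k. ln (sin (A y k - A y j)) + cot (A y k - A y j) * (e k - e j))"
        using pair by (auto intro: sum_mono)
      have "(\<Sum>j<k. ln (sin (A x k - A x j))) < (\<Sum>j<k. ln (sin (A y k - A y j)) + cot (A y k - A y j) * (e k - e j))"
        using pair[OF _ that] pair_strict[OF \<open>0 < k\<close> that ne] \<open>0 < k\<close>
          by (intro sum_strict_mono_ex1) auto
      then show "\<exists>k\<in>{..<d}. (\<Sum>j<k. ln (sin (A x k - A x j))) < (\<Sum>j<k. ln (sin (A y k - A y j)) + cot (A y k - A y j) * (e k - e j))"
        using that by auto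
    qed simp
    then show False using ST_eq by simp
  qed
  \<comment> \<open>A common shift makes \<open>D\<close> a multiple of the sum of the tangents,
    which is 0; by \<open>D_less\<close> the shift itself is then 0.\<close>
  have "D = (\<Sum>k<d. y k / a * e 0)" 
    unfolding D_def tan_A by (intro sum.cong refl arg_cong2[where f = "(*)"] e_const) simp
  also have "\<dots> = (\<Sum>k<d. y k) / a * e 0"
    by (simp add: sum_divide_distrib sum_distrib_right)
  finally have "D = 0" using centred by simp
  then have "e k = 0" using D_less k by force
  then have "x k / a = y k / a" by (simp add: e_def A_def arctan_eq_iff)
  then show "x k = y k" using a by simp
qed

subsection \<open>The parameter for a given modulus\<close>

definition H_real :: "nat \<Rightarrow> real \<Rightarrow> real" where
  "H_real d l = 1 + (\<Sum>k=1..d div 2. real (d choose (2 * k)) *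
     (real (odd_dfact k) / (\<Prod>j=1..k. l - 2 * real d + 2 * real j + 1)))"

lemma H_value_of_real: "H_value d (of_real l) = of_real (H_real d l)"
  unfolding H_value_def H_real_def
  by (subst sum.atLeast_Suc_atMost) (simp_all add: odd_dfact_def)

lemma odd_dfact_pos: "odd_dfact k > 0"
  unfolding odd_dfact_def by (intro prod_pos) auto

text \<open>From 2 d - 2 on, all factors of the denominators are positive and increase with the
  parameter; d >= 2 ensures that there is a summand.\<close>

lemma H_real_strict_antimono:
  assumes "d \<ge> 2" "2 * real d - 2 \<le> l" "l < l'"
  shows "H_real d l' < H_real d l"
  unfolding H_real_def
proof (intro add_strict_left_mono sum_strict_mono)
  fix k assume k: "k \<in> {1..d div 2}"
  have pos: "0 < (\<Prod>j=1..k. l - 2 * real d + 2 * real j + 1)"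
    using assms by (intro prod_pos) auto
  have "(\<Prod>j=1..k. l - 2 * real d + 2 * real j + 1) < (\<Prod>j=1..k. l' - 2 * real d + 2 * real j + 1)"
    using assms k by (intro prod_mono_strict) auto
  then show "real (d choose (2 * k)) * (real (odd_dfact k) / (\<Prod>j=1..k. l' - 2 * real d + 2 * real j + 1))
      < real (d choose (2 * k)) * (real (odd_dfact k) / (\<Prod>j=1..k. l - 2 * real d + 2 * real j + 1))"
    using k pos by (intro mult_strict_left_mono divide_strict_left_mono) (auto simp: odd_dfact_pos)
qed (use assms in auto)

lemma sum_even_binomials:
  assumes "d > 0"
  shows "(\<Sum>k=0..d div 2. real (d choose (2 * k))) = 2 ^ (d - 1)"
proof -
  have "(\<Sum>k=0..d div 2. real (d choose (2 * k))) = (\<Sum>i | i \<in> {..d} \<and> even i. real (d choose i))"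
    by (rule sum.reindex_bij_witness[of _ "\<lambda>i. i div 2" "\<lambda>k. 2 * k"]) auto
  also have "\<dots> = (\<Sum>i\<le>d. if even i then real (d choose i) else 0)"
    by (rule sum.inter_filter) simp
  also have "2 * \<dots> = 2 ^ d" using choose_even_sum[OF assms, where 'a = real] by simp
  finally have "2 * (\<Sum>k=0..d div 2. real (d choose (2 * k))) = 2 ^ d" .
  then show ?thesis using assms by (cases d) auto
qed

text \<open>At this end each denominator equals (2 k - 1)!! and cancels, leaving the even binomial
  coefficients. This is the origin of the upper bound on \<open>m\<close>.\<close>

lemma H_real_left_end:
  assumes "d \<ge> 1"
  shows "H_real d (2 * real d - 2) = 2 ^ (d - 1)"
proof -
  have "(\<Prod>j=1..k. 2 * real d - 2 - 2 * real d + 2 * real j + 1) = real (odd_dfact k)" for k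
    unfolding odd_dfact_def of_nat_prod by (intro prod.cong) (auto simp: of_nat_diff)
  then have "H_real d (2 * real d - 2) = 1 + (\<Sum>k=1..d div 2. real (d choose (2 * k)))"
    unfolding H_real_def by (simp add: odd_dfact_pos[THEN gr_implies_not0])
  also have "\<dots> = (\<Sum>k=0..d div 2. real (d choose (2 * k)))"
    by (subst (2) sum.atLeast_Suc_atMost) simp_all
  finally show ?thesis using sum_even_binomials assms by simp
qed

text \<open>Only the first factor of each denominator is kept, the others being at least 1. The
  bound tends to 1, so every value above 1 is eventually undercut.\<close>

lemma H_real_bound:
  assumes "2 * real d - 2 \<le> l"
  shows "H_real d l \<le> 1 + (\<Sum>k=1..d div 2. real (d choose (2 * k)) * real (odd_dfact k)) / (l - 2 * real d + 3)"
  unfolding H_real_def sum_divide_distrib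
proof (intro add_left_mono sum_mono)
  fix k assume k: "k \<in> {1..d div 2}"
  have "l - 2 * real d + 3 \<le> (l - 2 * real d + 3) * (\<Prod>j\<in>{1..k} - {1}. l - 2 * real d + 2 * real j + 1)"
    using assms by (intro mult_le_cancel_left1[THEN iffD2]) (auto intro!: prod_ge_1)
  also have "\<dots> = (\<Prod>j=1..k. l - 2 * real d + 2 * real j + 1)"
    using k by (subst (2) prod.remove[of _ 1]) auto
  finally have "real (odd_dfact k) / (\<Prod>j=1..k. l - 2 * real d + 2 * real j + 1) \<le> real (odd_dfact k) / (l - 2 * real d + 3)"
    using assms by (intro divide_left_mono mult_pos_pos) auto
  then show "real (d choose (2 * k)) * (real (odd_dfact k) / (\<Prod>j=1..k. l - 2 * real d + 2 * real j + 1))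
      \<le> real (d choose (2 * k)) * real (odd_dfact k) / (l - 2 * real d + 3)"
    using mult_left_mono by fastforce
qed

lemma ex1_H_real_eq:
  assumes d: "d \<ge> 2" and M: "1 < M" "M \<le> 2 ^ (d - 1)"
  shows "\<exists>!l. l \<ge> 2 * real d - 2 \<and> H_real d l = M"
proof -
  define C where "C = (\<Sum>k=1..d div 2. real (d choose (2 * k)) * real (odd_dfact k))"
  \<comment> \<open>Chosen so that the bound of \<open>H_real_bound\<close> at \<open>l1\<close> is
    at most \<open>M\<close>; it serves as right end for the intermediate value theorem.\<close>
  define l1 where "l1 = 2 * real d - 2 + C / (M - 1)"
  have "C \<ge> 0" unfolding C_def by (intro sum_nonneg) auto
  then have l1: "2 * real d - 2 \<le> l1" using M by (simp add: l1_def)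
  have "C = (M - 1) * (C / (M - 1))" using M by simp
  also have "\<dots> \<le> (M - 1) * (l1 - 2 * real d + 3)"
    using M by (intro mult_left_mono) (auto simp: l1_def)
  finally have "C / (l1 - 2 * real d + 3) \<le> M - 1"
    using l1 by (simp add: divide_le_eq)
  then have "H_real d l1 \<le> M" using H_real_bound[OF l1] by (simp add: C_def)
  moreover have "M \<le> H_real d (2 * real d - 2)" using H_real_left_end[of d] M d by simp
  moreover have "continuous_on {2 * real d - 2..l1} (H_real d)"
    unfolding H_real_def[abs_def] by (intro continuous_intros) auto
  ultimately obtain l where "2 * real d - 2 \<le> l" "H_real d l = M"
    using IVT2'[of "H_real d" l1 M "2 * real d - 2"] l1 by blast
  then show ?thesis
    using H_real_strict_antimono[OF d] by (metis linorder_neqE_linordered_idom less_irrefl)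
qed

section \<open>From real-rooted polynomials to increasing root vectors\<close>

lemma poly_disc_real_roots:
  fixes y :: "nat \<Rightarrow> real"
  shows
  "poly_disc (\<Prod>k<d. [:- of_real (y k), 1:]) = of_real (\<Prod>k<d. \<Prod>j<k. (y j - y k)\<^sup>2)"
proof -
  have "(\<Prod>k<d. [:- of_real (y k), 1:]) = (\<Prod>x\<leftarrow>map (\<lambda>k. complex_of_real (y k)) [0..<d]. [:- x, 1:])"
    unfolding prod_list_roots_nth by simp
  from poly_disc_eq[OF this] show ?thesis by simp
qed

lemma exp_log_discriminant:
  fixes y :: "nat \<Rightarrow> real"
  assumes "\<And>j k. j < k \<Longrightarrow> k < d \<Longrightarrow> y j < y k"
  shows "(\<Prod>k<d. \<Prod>j<k. (y j - y k)\<^sup>2) = exp (2 * (\<Sum>k<d. \<Sum>j<k. ln (y k - y j)))"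
proof -
  have "(y j - y k)\<^sup>2 = exp (2 * ln (y k - y j))" if "k < d" "j < k" for j k
  proof -
    have "y k - y j > 0" using assms that by simp
    moreover have "exp (2 * ln (y k - y j)) = (exp (ln (y k - y j)))\<^sup>2"
      by (simp add: exp_double)
    ultimately show ?thesis by (simp add: power2_commute)
  qed
  moreover have "exp (2 * (\<Sum>k<d. \<Sum>j<k. ln (y k - y j))) = (\<Prod>k<d. \<Prod>j<k. exp (2 * ln (y k - y j)))"
    by (simp only: sum_distrib_left exp_sum finite_lessThan)
  ultimately show ?thesis by (auto intro!: prod.cong)
qed

lemma strict_of_discriminant_nonzero:
  fixes ys :: "real list"
  assumes "sorted ys" "(\<Prod>k<length ys. \<Prod>j<k. (ys ! j - ys ! k)\<^sup>2) \<noteq> 0" "j < k" "k < length ys"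
  shows "ys ! j < ys ! k"
proof -
  have "ys ! j \<noteq> ys ! k" using assms(2-4) by auto
  then show ?thesis using sorted_nth_mono[OF assms(1), of j k] assms(3,4) by simp
qed

lemma coeff_prod_roots_degree:
  "coeff (\<Prod>k<n. [:- y k, 1:]) n = (1 :: 'a :: comm_ring_1)"
proof (induction n)
  case (Suc n)
  have "coeff (\<Prod>k<n. [:- y k, 1:]) (Suc n) = 0"
  proof (rule coeff_eq_0)
    have "degree (\<Prod>k<n. [:- y k, 1:]) \<le> (\<Sum>k<n. degree [:- y k, 1:])"
      using degree_prod_sum_le[of "{..<n}" "\<lambda>k. [:- y k, 1:]"]
        by (simp only: o_def finite_lessThan)
    also have "\<dots> \<le> n" by simp
    finally show "degree (\<Prod>k<n. [:- y k, 1:]) < Suc n" by simp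
  qed
  with Suc show ?case by simp
qed simp

lemma coeff_prod_roots_subleading:
  "coeff (\<Prod>k<Suc n. [:- y k, 1:]) n = - (\<Sum>k<Suc n. y k :: 'a :: comm_ring_1)"
proof (induction n)
  case (Suc n)
  have "coeff (\<Prod>k<Suc (Suc n). [:- y k, 1:]) (Suc n) = coeff (\<Prod>k<Suc n. [:- y k, 1:]) n - y (Suc n) * coeff (\<Prod>k<Suc n. [:- y k, 1:]) (Suc n)"
    by (subst prod.lessThan_Suc) (simp del: prod.lessThan_Suc)
  then show ?case unfolding Suc.IH coeff_prod_roots_degree by simp
qed simp

lemma cmod_poly_real_roots_imag:
  fixes y :: "nat \<Rightarrow> real"
  shows
  "(cmod (poly (\<Prod>k<d. [:- of_real (y k), 1:]) (of_real a * \<i>)))\<^sup>2 = (\<Prod>k<d. (y k)\<^sup>2 + a\<^sup>2)"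
proof -
  have "cmod (of_real a * \<i> - of_real u) ^ 2 = u\<^sup>2 + a\<^sup>2" for u
    by (simp add: cmod_power2)
  then show ?thesis by (simp add: poly_prod prod_power_distrib flip: prod_norm)
qed

text \<open>With G = (x - y_j) F, at y_j one has G = 0, G' = F and G'' = 2 F'. The differential
  equation thus determines 2 F' / F, which is the sum on the left.\<close>

lemma G_poly_critical:
  fixes y :: "nat \<Rightarrow> real"
  assumes a: "a > 0" and l: "nonsingular d (of_real l)"
    and G: "G_poly d (of_real a) (of_real l) = (\<Prod>k<d. [:- of_real (y k), 1:])"
    and y: "\<And>k. k < d \<Longrightarrow> k \<noteq> j \<Longrightarrow> y j \<noteq> y k" and j: "j < d"
  shows "(\<Sum>k\<in>{..<d} - {j}. 2 / (y j - y k)) = l * y j / ((y j)\<^sup>2 + a\<^sup>2)"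
proof -
  define F where "F = (\<Prod>k\<in>{..<d} - {j}. [:- complex_of_real (y k), 1:])"
  define S where "S = (\<Sum>k\<in>{..<d} - {j}. 2 / (y j - y k))"
  have GF: "G_poly d (of_real a) (of_real l) = [:- of_real (y j), 1:] * F"
    unfolding G F_def using j by (subst prod.remove[of _ j]) auto
  have F0: "poly F (of_real (y j)) \<noteq> 0"
    using y by (auto simp: F_def poly_prod)
  have "2 * poly (pderiv F) (of_real (y j)) = poly F (of_real (y j)) * of_real S"
    unfolding F_def S_def
    by (subst pderiv_prod_roots) (use y in \<open>auto simp: poly_prod sum_distrib_left mult.commute\<close>)
  moreover have "((of_real (y j))\<^sup>2 + (of_real a)\<^sup>2) * (2 * poly (pderiv F) (of_real (y j)))
      = of_real l * of_real (y j) * poly F (of_real (y j))"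
    using G_poly_ode[OF l, of "of_real (y j)" "of_real a"]
    unfolding GF pderiv2_at_root pderiv_linear_mult by simp
  ultimately have "poly F (of_real (y j)) * of_real (((y j)\<^sup>2 + a\<^sup>2) * S) = poly F (of_real (y j)) * of_real (l * y j)"
    by (simp add: ac_simps)
  then have "complex_of_real (((y j)\<^sup>2 + a\<^sup>2) * S) = of_real (l * y j)"
    unfolding mult_cancel_left using F0 by blast
  then have "((y j)\<^sup>2 + a\<^sup>2) * S = l * y j" unfolding of_real_eq_iff .
  moreover have "(y j)\<^sup>2 + a\<^sup>2 > 0" using a by (simp add: add_nonneg_pos)
  ultimately have "S = l * y j / ((y j)\<^sup>2 + a\<^sup>2)"
    by (simp add: nonzero_eq_divide_eq[OF less_imp_neq[symmetric]] mult.commute)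
  then show ?thesis by (simp only: S_def)
qed

text \<open>All linear factors in \<open>l\<close> are positive in this range. Through
  \<open>poly_disc_G_poly\<close> the roots of the extremal polynomial are simple.\<close>

lemma disc_formula_nonzero:
  assumes "a > 0" "l \<ge> 2 * real d - 2" "d \<ge> 1"
  shows "disc_formula d (of_real a) (of_real l) \<noteq> 0"
proof -
  have "complex_of_real l - 2 * of_nat k \<noteq> 0" if "k \<in> {1..d div 2 - 1}" for k
  proof -
    have "l - 2 * real k \<noteq> 0" using that assms(2) by auto
    then have "complex_of_real (l - 2 * real k) \<noteq> 0" unfolding of_real_eq_0_iff .
    then show ?thesis by simp
  qed
  moreover have "complex_of_real l - 2 * of_nat k + 1 \<noteq> 0"
    if "k \<in> {(d + 1) div 2..d - 1}" for k
  proof -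
    have "real k \<le> real d - 1" using that assms(3) by auto
    then have "l - 2 * real k + 1 \<noteq> 0" using assms(2) by auto
    then have "complex_of_real (l - 2 * real k + 1) \<noteq> 0" unfolding of_real_eq_0_iff .
    then show ?thesis by simp
  qed
  ultimately show ?thesis using assms(1) by (auto simp: disc_formula_def)
qed

lemma admissible_roots_real:
  assumes "admissible d a m f" "poly f z = 0"
  shows "z \<in> \<real>"
proof -
  have "f \<noteq> 0" using assms(1) by (auto simp: admissible_def)
  have "size (proots f) = size {#z \<in># proots f. z \<in> \<real>#} + size {#z \<in># proots f. z \<notin> \<real>#}"
    by (metis multiset_partition size_union)
  then have "{#z \<in># proots f. z \<notin> \<real>#} = {#}"
  proof -
    have "size (proots f) = d" "size {#z \<in># proots f. z \<in> \<real>#} = d"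
      using assms(1) size_proots_complex[of f] by (auto simp: admissible_def)
    with \<open>size (proots f) = _ + _\<close> have "size {#z \<in># proots f. z \<notin> \<real>#} = 0"
      by linarith
    then show ?thesis by simp
  qed
  moreover have "z \<in># proots f" using assms(2) \<open>f \<noteq> 0\<close> by simp
  ultimately show ?thesis by (metis (mono_tags, lifting) empty_not_add_mset filter_mset_eq_conv multi_member_split set_mset_filter mem_Collect_eq empty_iff set_mset_empty)
qed

lemma admissibleI:
  assumes "degree f = d" "lead_coeff f = 1" "\<And>z. poly f z = 0 \<Longrightarrow> z \<in> \<real>" "cmod (poly f (of_real a * \<i>)) = m"
  shows "admissible d a m f"
proof -
  have "f \<noteq> 0" using assms(2) by auto
  then have "{#z \<in># proots f. z \<in> \<real>#} = proots f"
    using assms(3) by (intro filter_mset_cong[THEN trans, OF refl _ filter_mset_True]) auto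
  then show ?thesis using assms size_proots_complex[of f] by (simp add: admissible_def)
qed

subsection \<open>Extremality\<close>

lemma G_poly_maximal:
  assumes a: "a > 0" and d: "d \<ge> 2" and l: "l \<ge> 2 * real d - 2" and H: "H_real d l = m / a ^ d"
  defines "G \<equiv> G_poly d (of_real a) (of_real l)"
  shows "admissible d a m G"
    and "admissible d a m f \<Longrightarrow> poly_disc f \<le> poly_disc G"
    and "admissible d a m f \<Longrightarrow> poly_disc f = poly_disc G \<Longrightarrow> f = G"
proof -
  have G_real: "z \<in> \<real>" if "poly G z = 0" for z
    using G_poly_roots_real[OF a l] that by (simp add: G_def)
  have "m > 0"
  proof -
    have "H_real d l \<ge> 1" unfolding H_real_def using l
      by (auto intro!: sum_nonneg prod_nonneg divide_nonneg_nonneg mult_nonneg_nonneg)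
    then have "0 < m / a ^ d" by (simp add: H)
    then show ?thesis using a by (simp add: zero_less_divide_iff)
  qed
  have "poly G (of_real a * \<i>) = (of_real a * \<i>) ^ d * of_real (m / a ^ d)"
    unfolding G_def by (subst poly_G_poly_imag) (simp_all add: power_mult_distrib H_value_of_real H)
  then have "cmod (poly G (of_real a * \<i>)) = a ^ d * (m / a ^ d)"
    using a \<open>m > 0\<close> by (simp add: norm_mult norm_power norm_divide)
  then have "cmod (poly G (of_real a * \<i>)) = m" using a by simp
  then show admG: "admissible d a m G"
    using G_real by (intro admissibleI) (simp_all add: G_def)
  obtain ys :: "real list" where G: "G = (\<Prod>k<d. [:- of_real (ys ! k), 1:])" and ys: "length ys = d" "sorted ys"
    using real_roots_list[of G] G_real by (metis G_def degree_G_poly coeff_G_poly_degree)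
  define \<Delta> where "\<Delta> xs = (\<Prod>k<d. \<Prod>j<k. (xs ! j - xs ! k)\<^sup>2)" for xs :: "real list"
  have disc_G: "poly_disc G = of_real (\<Delta> ys)"
    unfolding G poly_disc_real_roots \<Delta>_def ..
  \<comment> \<open>Simple roots are needed for a strictly increasing root vector, on which the
    logarithms are meaningful.\<close>
  have "poly_disc G \<noteq> 0"
    using poly_disc_G_poly[OF _ nonsingular_of_real[OF l], of "of_real a"] disc_formula_nonzero[OF a l] d
    by (simp add: G_def)
  then have "\<Delta> ys \<noteq> 0" by (simp add: disc_G)
  then have ys_less: "ys ! j < ys ! k" if "j < k" "k < d" for j k
    using strict_of_discriminant_nonzero[of ys j k] ys that by (simp add: \<Delta>_def)
  have nonneg: "\<Delta> xs \<ge> 0" for xs unfolding \<Delta>_def by (intro prod_nonneg) auto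
  have crit: "(\<Sum>k\<in>{..<d} - {j}. 2 / (ys ! j - ys ! k)) = l * ys ! j / ((ys ! j)\<^sup>2 + a\<^sup>2)"
    if "j < d" for j
    using G_poly_critical[OF a nonsingular_of_real[OF l], of "\<lambda>k. ys ! k" j] that ys_less G
    by (metis (no_types, lifting) G_def linorder_neqE_nat less_irrefl)
  \<comment> \<open>Powers in \<open>G\<close> drop in steps of two, so the subleading coefficient,
    minus the sum of the roots, is 0.\<close>
  have centred: "(\<Sum>k<d. ys ! k) = 0"
  proof -
    obtain n where n: "d = Suc n" using d by (cases d) auto
    have "coeff G n = 0" unfolding G_def coeff_G_poly by (simp add: n)
    then have "(\<Sum>k<d. complex_of_real (ys ! k)) = 0"
      unfolding G n coeff_prod_roots_subleading by (simp del: sum.lessThan_Suc)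
    then show ?thesis by (simp flip: of_real_sum)
  qed
  have modulus: "(\<Prod>k<d. (xs ! k)\<^sup>2 + a\<^sup>2) = m\<^sup>2"
    if "admissible d a m (\<Prod>k<d. [:- of_real (xs ! k), 1:])" for xs :: "real list"
    using that cmod_poly_real_roots_imag[of "\<lambda>k. xs ! k" d a] unfolding admissible_def by metis
  have "poly_disc f \<le> poly_disc G \<and> (poly_disc f = poly_disc G \<longrightarrow> f = G)"
    if f_adm: "admissible d a m f" for f
  proof -
    have "lead_coeff f = 1" "degree f = d" using f_adm by (auto simp: admissible_def)
    then obtain xs :: "real list" where f: "f = (\<Prod>k<d. [:- of_real (xs ! k), 1:])" and xs: "length xs = d" "sorted xs"
      using real_roots_list[of f] admissible_roots_real[OF f_adm] by metis
    have disc_f: "poly_disc f = of_real (\<Delta> xs)"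
      unfolding f poly_disc_real_roots \<Delta>_def ..
    show ?thesis
    proof (cases "\<Delta> xs = 0")
      case True
      then show ?thesis using nonneg[of ys] \<open>\<Delta> ys \<noteq> 0\<close>
        by (simp add: disc_f disc_G less_eq_complex_def)
    next
      case False
      then have xs_less: "xs ! j < xs ! k" if "j < k" "k < d" for j k
        using strict_of_discriminant_nonzero[of xs j k] xs that by (simp add: \<Delta>_def)
      have prod_eq: "(\<Prod>k<d. (xs ! k)\<^sup>2 + a\<^sup>2) = (\<Prod>k<d. (ys ! k)\<^sup>2 + a\<^sup>2)"
        using modulus[of xs] modulus[of ys] f_adm admG by (simp add: f G)
      have exp: "\<Delta> xs = exp (2 * (\<Sum>k<d. \<Sum>j<k. ln (xs ! k - xs ! j)))"
        "\<Delta> ys = exp (2 * (\<Sum>k<d. \<Sum>j<k. ln (ys ! k - ys ! j)))"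
        unfolding \<Delta>_def using xs_less ys_less by (intro exp_log_discriminant; blast)+
      have "\<Delta> xs \<le> \<Delta> ys"
        unfolding exp using log_discriminant_le(1)[OF a d l xs_less ys_less crit centred prod_eq] by simp
      moreover have "f = G" if "\<Delta> xs = \<Delta> ys"
      proof -
        have "(\<Sum>k<d. \<Sum>j<k. ln (xs ! k - xs ! j)) = (\<Sum>k<d. \<Sum>j<k. ln (ys ! k - ys ! j))"
          using that unfolding exp by simp
        then have "xs ! k = ys ! k" if "k < d" for k
          using log_discriminant_le(2)[OF a d l xs_less ys_less crit centred prod_eq] that by blast
        then show ?thesis unfolding f G by (intro prod.cong) auto
      qed
      ultimately show ?thesis by (simp add: disc_f disc_G less_eq_complex_def)
    qed
  qed
  then show "admissible d a m f \<Longrightarrow> poly_disc f \<le> poly_disc G"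
    and "admissible d a m f \<Longrightarrow> poly_disc f = poly_disc G \<Longrightarrow> f = G"
      by blast+
qed

theorem theorem5:
  shows
    "(\<forall>(a::real) (d::nat) (m::real).
        a > 0 \<and> d \<ge> 2 \<and> a ^ d < m \<and> m \<le> 2 ^ (d - 1) * a ^ d \<longrightarrow>
        (let is_lam0 = (\<lambda>l::real. l \<ge> 2 * real d - 2 \<and>
               1 + (\<Sum>k=1..d div 2. real (d choose (2 * k)) *
                      (real (odd_dfact k) /
                       (\<Prod>j=1..k. l - 2 * real d + 2 * real j + 1))) = m / a ^ d)
         in (\<exists>!l. is_lam0 l) \<and>
            (\<forall>l. is_lam0 l \<longrightarrow>
               (let G = G_poly d (complex_of_real a) (complex_of_real l)
                in (\<forall>f. admissible d a m f \<longrightarrow> poly_disc f \<le> poly_disc G) \<and>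
                   (\<forall>f. admissible d a m f \<and> poly_disc f = poly_disc G \<longleftrightarrow> f = G))))) \<and>
     (\<forall>(d::nat) (l::complex) (a::complex).
        d \<ge> 2 \<and> l \<notin> {2 * of_nat k - 1 | k. (d + 1) div 2 \<le> k \<and> k \<le> d - 1} \<longrightarrow>
        poly_disc (G_poly d a l) =
          a ^ (d * (d - 1)) *
          (((\<Prod>k=1..d. of_nat k ^ k) * (\<Prod>k=1..d div 2 - 1. (l - 2 * of_nat k) ^ (2 * k))) /
           (\<Prod>k=(d + 1) div 2..d - 1. (l - 2 * of_nat k + 1) ^ (2 * k - 1))))"
  unfolding Let_def H_real_def[symmetric] disc_formula_def[symmetric]
proof (intro conjI allI impI)
  fix a m :: real and d :: nat
  assume "a > 0 \<and> d \<ge> 2 \<and> a ^ d < m \<and> m \<le> 2 ^ (d - 1) * a ^ d"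
  then have *: "d \<ge> 2" "1 < m / a ^ d" "m / a ^ d \<le> 2 ^ (d - 1)"
    by (simp_all add: divide_le_eq less_divide_eq)
  from ex1_H_real_eq[OF *] show "\<exists>!l. 2 * real d - 2 \<le> l \<and> H_real d l = m / a ^ d" .
next
  fix a m l :: real and d :: nat and f
  assume "a > 0 \<and> d \<ge> 2 \<and> a ^ d < m \<and> m \<le> 2 ^ (d - 1) * a ^ d"
    and "2 * real d - 2 \<le> l \<and> H_real d l = m / a ^ d"
  then have *: "a > 0" "d \<ge> 2" "2 * real d - 2 \<le> l" "H_real d l = m / a ^ d" by auto
  show "poly_disc f \<le> poly_disc (G_poly d (of_real a) (of_real l))" if "admissible d a m f"
    using G_poly_maximal(2)[OF * that] .
  \<comment> \<open>The direction from right to left is the admissibility of the extremal polynomial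
    itself.\<close>
  show "admissible d a m f \<and> poly_disc f = poly_disc (G_poly d (of_real a) (of_real l)) \<longleftrightarrow>
      f = G_poly d (of_real a) (of_real l)"
    using G_poly_maximal(1,3)[OF *] by blast
next
  fix d :: nat and l a :: complex
  assume "d \<ge> 2 \<and> l \<notin> {2 * of_nat k - 1 | k. (d + 1) div 2 \<le> k \<and> k \<le> d - 1}"
  then show "poly_disc (G_poly d a l) = disc_formula d a l"
    using nonsingular_iff[of d l] poly_disc_G_poly[of d l a] by simp
qed

end
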